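(* Let $K$ be an algebraically closed field of characteristic zero. Let $X_1,\ldots,X_s\subseteq\mathbb{A}_K^N$ be irreducible affine cones with join $X = X_1+\cdots+X_s$. Then $M(X) = M(X_1)\vee\cdots\vee M(X_s)$ (i.e. $M(X)$ is a Terracini union) if and only if there does not exist a basis $B$ of $M(X_1)\vee\cdots\vee M(X_s)$ such that the join \[ \overline{\pi_B(X_1)}+\cdots+\overline{\pi_B(X_s)} \subseteq \mathbb{A}_K^B \] is defective.
   Context: An affine cone $X\subseteq\mathbb{A}^N$ is a variety with homogeneous vanishing ideal $\mathcal{I}(X)\subseteq K[z_1,\ldots,z_N]$. The join of irreducible affine cones $Y_1,\ldots,Y_s$ in an affine space $\mathbb{A}^M$ is $Y_1+\cdots+Y_s=\overline{\{y_1+\cdots+y_s: y_i\in Y_i\}}$; it is defective if its dimension is less than $\min\{\dim Y_1+\cdots+\dim Y_s, M\}$. For an irreducible variety $X\subseteq\mathbb{A}^N$, the algebraic matroid $M(X)$ is the matroid on $Z=\{z_1,\ldots,z_N\}$ in which $E\subseteq Z$ is independent iff $\mathcal{I}(X)\cap K[E]=\langle 0\rangle$. The matroid union $M_1\vee\cdots\vee M_s$ has as independent sets all unions $I_1\cup\cdots\cup I_s$ with $I_i$ independent in $M_i$. For $E\subseteq Z$ (identified with a subset of $[N]$), $\pi_E:\mathbb{A}^N\to\mathbb{A}^E$ is the coordinate projection onto the coordinates indexed by $E$. $M(X)$ is called a Terracini union if equality $M(X)=M(X_1)\vee\cdots\vee M(X_s)$ holds. *)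

theory Defs
  imports
    "HOL-Computational_Algebra.Polynomial"
    "HOL-Library.Poly_Mapping"
    "HOL-Library.Extended_Nat"
begin

section \<open>Polynomials in several variables\<close>

text \<open>
  Variables are indexed by natural numbers. A polynomial is a finitely supported map from
  exponent vectors to coefficients, with the ring structure of \<^theory>\<open>HOL-Library.Poly_Mapping\<close>.
\<close>

type_synonym 'k mpol = "(nat \<Rightarrow>\<^sub>0 nat) \<Rightarrow>\<^sub>0 'k"

text \<open>The subring \<open>K[E]\<close> of polynomials that involve only variables with index in \<open>E\<close>.\<close>

definition poly_ring :: "nat set \<Rightarrow> 'k::field mpol set" where
  "poly_ring E = {p. \<forall>m\<in>Poly_Mapping.keys p. Poly_Mapping.keys m \<subseteq> E}"

definition eval_mpol :: "(nat \<Rightarrow> 'k::field) \<Rightarrow> 'k mpol \<Rightarrow> 'k" where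
  "eval_mpol x p =
     (\<Sum>m\<in>Poly_Mapping.keys p.
        Poly_Mapping.lookup p m * (\<Prod>i\<in>Poly_Mapping.keys m. x i ^ Poly_Mapping.lookup m i))"

definition mono_degree :: "(nat \<Rightarrow>\<^sub>0 nat) \<Rightarrow> nat" where
  "mono_degree m = (\<Sum>i\<in>Poly_Mapping.keys m. Poly_Mapping.lookup m i)"

definition hom_component :: "nat \<Rightarrow> 'k::field mpol \<Rightarrow> 'k mpol" where
  "hom_component d p =
     (\<Sum>m\<in>{m\<in>Poly_Mapping.keys p. mono_degree m = d}.
        Poly_Mapping.single m (Poly_Mapping.lookup p m))"

text \<open>Applied to ideals only: \<open>I = \<Oplus>\<^sub>d (I \<inter> K[E]\<^sub>d)\<close>.\<close>

definition homogeneous_ideal :: "'k::field mpol set \<Rightarrow> bool" where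
  "homogeneous_ideal I \<longleftrightarrow> (\<forall>p\<in>I. \<forall>d. hom_component d p \<in> I)"


section \<open>Affine varieties\<close>

text \<open>
  For a finite set \<open>E\<close> of indices, a point of \<open>\<bbbA>\<^sup>E\<close> is a family of coordinates that vanishes
  outside \<open>E\<close>; so all \<open>\<bbbA>\<^sup>E\<close> live in one type, and \<open>\<bbbA>\<^sup>N\<close> is \<open>affine_space {1..N}\<close>.
\<close>

definition affine_space :: "nat set \<Rightarrow> (nat \<Rightarrow> 'k::field) set" where
  "affine_space E = {x. \<forall>i. i \<notin> E \<longrightarrow> x i = 0}"

definition coord_proj :: "nat set \<Rightarrow> (nat \<Rightarrow> 'k::field) \<Rightarrow> (nat \<Rightarrow> 'k)" where
  "coord_proj E x = (\<lambda>i. if i \<in> E then x i else 0)"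

definition zero_locus :: "nat set \<Rightarrow> 'k::field mpol set \<Rightarrow> (nat \<Rightarrow> 'k) set" where
  "zero_locus E S = {x \<in> affine_space E. \<forall>p\<in>S. eval_mpol x p = 0}"

definition vanishing_ideal :: "nat set \<Rightarrow> (nat \<Rightarrow> 'k::field) set \<Rightarrow> 'k mpol set" where
  "vanishing_ideal E X = {p \<in> poly_ring E. \<forall>x\<in>X. eval_mpol x p = 0}"

definition zariski_closed :: "nat set \<Rightarrow> (nat \<Rightarrow> 'k::field) set \<Rightarrow> bool" where
  "zariski_closed E X \<longleftrightarrow> (\<exists>S \<subseteq> poly_ring E. X = zero_locus E S)"

definition zariski_closure :: "nat set \<Rightarrow> (nat \<Rightarrow> 'k::field) set \<Rightarrow> (nat \<Rightarrow> 'k) set" where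
  "zariski_closure E X = \<Inter>{Y. zariski_closed E Y \<and> X \<subseteq> Y}"

definition irreducible_variety :: "nat set \<Rightarrow> (nat \<Rightarrow> 'k::field) set \<Rightarrow> bool" where
  "irreducible_variety E X \<longleftrightarrow>
     zariski_closed E X \<and> X \<noteq> {} \<and>
     (\<forall>Y Z. zariski_closed E Y \<and> zariski_closed E Z \<and> X = Y \<union> Z \<longrightarrow> X = Y \<or> X = Z)"

definition affine_cone :: "nat set \<Rightarrow> (nat \<Rightarrow> 'k::field) set \<Rightarrow> bool" where
  "affine_cone E X \<longleftrightarrow> zariski_closed E X \<and> homogeneous_ideal (vanishing_ideal E X)"

text \<open>
  The regular functions on \<open>X\<close> given by the polynomials \<open>f 0, \<dots>, f (n - 1)\<close> are algebraically
  independent over \<open>K\<close> in the coordinate ring \<open>K[X]\<close>: no nonzero polynomial \<open>q\<close> in \<open>n\<close> variables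
  satisfies \<open>q(f 0, \<dots>, f (n - 1)) = 0\<close> as a function on \<open>X\<close>.
\<close>

definition alg_independent_on ::
    "nat set \<Rightarrow> (nat \<Rightarrow> 'k::field) set \<Rightarrow> nat \<Rightarrow> (nat \<Rightarrow> 'k mpol) \<Rightarrow> bool" where
  "alg_independent_on E X n f \<longleftrightarrow>
     (\<forall>i<n. f i \<in> poly_ring E) \<and>
     (\<forall>q \<in> poly_ring {..<n}. (\<forall>x\<in>X. eval_mpol (\<lambda>i. if i < n then eval_mpol x (f i) else 0) q = 0)
        \<longrightarrow> q = 0)"

text \<open>
  The dimension of a variety as the transcendence degree over \<open>K\<close> of its coordinate ring \<open>K[X]\<close>;
  for irreducible \<open>X\<close> this is the transcendence degree of the function field \<open>K(X)\<close>.
\<close>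

definition variety_dim :: "nat set \<Rightarrow> (nat \<Rightarrow> 'k::field) set \<Rightarrow> enat" where
  "variety_dim E X = (SUP n \<in> {n. \<exists>f. alg_independent_on E X n f}. enat n)"


section \<open>Joins\<close>

definition join :: "nat set \<Rightarrow> nat \<Rightarrow> (nat \<Rightarrow> (nat \<Rightarrow> 'k::field) set) \<Rightarrow> (nat \<Rightarrow> 'k) set" where
  "join E s Y = zariski_closure E {(\<lambda>j. \<Sum>i=1..s. y i j) |y. \<forall>i\<in>{1..s}. y i \<in> Y i}"

definition defective_join :: "nat set \<Rightarrow> nat \<Rightarrow> (nat \<Rightarrow> (nat \<Rightarrow> 'k::field) set) \<Rightarrow> bool" where
  "defective_join E s Y \<longleftrightarrow>
     variety_dim E (join E s Y) < min (\<Sum>i=1..s. variety_dim E (Y i)) (enat (card E))"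


section \<open>Matroids\<close>

text \<open>The matroid axioms are not part of the type.\<close>

datatype 'a matroid = Matroid (ground: "'a set") (indep_sets: "'a set set")

definition matroid_basis :: "'a matroid \<Rightarrow> 'a set \<Rightarrow> bool" where
  "matroid_basis M B \<longleftrightarrow>
     B \<in> indep_sets M \<and> (\<forall>I \<in> indep_sets M. B \<subseteq> I \<longrightarrow> I = B)"

definition matroid_union :: "nat \<Rightarrow> (nat \<Rightarrow> 'a matroid) \<Rightarrow> 'a matroid" where
  "matroid_union s M =
     Matroid (\<Union>i\<in>{1..s}. ground (M i))
             {(\<Union>i\<in>{1..s}. J i) |J. \<forall>i\<in>{1..s}. J i \<in> indep_sets (M i)}"

text \<open>The variable \<open>z\<^sub>i\<close> is identified with its index \<open>i\<close>.\<close>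

definition alg_matroid :: "nat set \<Rightarrow> (nat \<Rightarrow> 'k::field) set \<Rightarrow> nat matroid" where
  "alg_matroid Z X = Matroid Z {E. E \<subseteq> Z \<and> vanishing_ideal Z X \<inter> poly_ring E = {0}}"

end

theory Submission
  imports Defs "HOL-Library.FuncSet"
begin

text \<open>
  All dimension counts are made with the growth of \<open>dim K[F]\<^bsub>\<le>d\<^esub>\<close> restricted to a set \<open>S\<close>
  of points. On an irreducible set, a maximal independent subset \<open>I\<close> of \<open>F\<close> forces growth of order at
  most \<open>|I|\<close>, while \<open>n\<close> algebraically independent polynomials force order at least \<open>n\<close>; so the growth
  exponent is the rank of \<open>F\<close> in the algebraic matroid. Growth exponents add up under Minkowski sums.
  Hence a set \<open>F\<close> that is independent in the join satisfies \<open>|F'| \<le> \<Sum>\<^sub>i r\<^sub>i(F')\<close> for all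
  \<open>F' \<subseteq> F\<close>, and by the matroid union theorem it is independent in the union of the matroids. Conversely,
  a basis \<open>B\<close> of the union is independent in the join iff the join of the projections to \<open>B\<close> has
  dimension \<open>|B|\<close>, that is, iff it is not defective.
\<close>

section \<open>Polynomial functions of bounded degree\<close>

text \<open>This destruction rule loops in combination with the rewrite rule \<open>in_keys_iff\<close>.\<close>

declare lookup_eq_zero_in_keys_contradict [rule del]

text \<open>Growth is measured on arbitrary sets of points, because a point of the bare set of sums
  comes with summands while a point of its closure need not; closures enter only through density.
  \<open>growth\<close> itself asserts only an upper bound. The lower bound is a count: the
  monomials with exponents at most \<open>d\<close> in \<open>n\<close> independent functions number
  (d+1)^n, and a linear relation among them would be an algebraic relation. The two halves together
  say that no independent subset of \<open>F\<close> is larger than a maximal one, which is the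
  matroid axiom for M(X). The delicate step is that a coordinate algebraic over others need not be
  integral over them: powers of the leading coefficient of its equation must be divided out, at the
  price of the points where it vanishes, and irreducibility keeps the remaining points dense. Bases
  suffice because independence in the join always implies independence in the union. The pieces of a
  basis \<open>B\<close> are independent in the single cones, so the dimensions of the projections
  sum to at least |B|; the minimum in the definition of a defective join is thus |B|.\<close>

definition mon :: "(nat \<Rightarrow>\<^sub>0 nat) \<Rightarrow> (nat \<Rightarrow> 'k::field) \<Rightarrow> 'k" where
  "mon m x = (\<Prod>i\<in>Poly_Mapping.keys m. x i ^ Poly_Mapping.lookup m i)"

lemma mon_superset:
  assumes "finite A" "Poly_Mapping.keys m \<subseteq> A"
  shows "mon m x = (\<Prod>i\<in>A. x i ^ Poly_Mapping.lookup m i)"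
  unfolding mon_def using assms by (intro prod.mono_neutral_left) (auto simp: in_keys_iff)

lemma mon_0 [simp]: "mon 0 x = 1"
  by (simp add: mon_def)

lemma mon_single [simp]: "mon (Poly_Mapping.single i k) x = x i ^ k"
  by (simp add: mon_def)

lemma mon_add: "mon (m + m') x = mon m x * mon m' x"
proof -
  let ?A = "Poly_Mapping.keys m \<union> Poly_Mapping.keys m'"
  have "mon (m + m') x = (\<Prod>i\<in>?A. x i ^ Poly_Mapping.lookup (m + m') i)"
    by (rule mon_superset) (use keys_add[of m m'] in auto)
  moreover have "mon m x = (\<Prod>i\<in>?A. x i ^ Poly_Mapping.lookup m i)"
    by (rule mon_superset) auto
  moreover have "mon m' x = (\<Prod>i\<in>?A. x i ^ Poly_Mapping.lookup m' i)"
    by (rule mon_superset) auto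
  ultimately show ?thesis
    by (simp add: lookup_add power_add prod.distrib)
qed

lemma eval_mpol_superset:
  assumes "finite A" "Poly_Mapping.keys p \<subseteq> A"
  shows "eval_mpol x p = (\<Sum>m\<in>A. Poly_Mapping.lookup p m * mon m x)"
  unfolding eval_mpol_def mon_def[symmetric] using assms
  by (intro sum.mono_neutral_left) (auto simp: in_keys_iff)

lemma mon_cong:
  assumes "Poly_Mapping.keys m \<subseteq> F" "\<And>i. i \<in> F \<Longrightarrow> x i = y i"
  shows "mon m x = mon m y"
  unfolding mon_def using assms by (intro prod.cong) auto

lemma eval_mpol_cong:
  assumes "p \<in> poly_ring F" "\<And>i. i \<in> F \<Longrightarrow> x i = y i"
  shows "eval_mpol x p = eval_mpol y p"
  unfolding eval_mpol_def mon_def[symmetric] using assms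
  by (intro sum.cong refl arg_cong2[where f = "(*)"] mon_cong[of _ F]) (auto simp: poly_ring_def)

text \<open>Linear algebra produces coefficient families, whereas independence and dimension speak
  of polynomials; this is the bridge. Values of \<open>c\<close> outside \<open>M\<close> are
  ignored.\<close>

definition mpol_of :: "(nat \<Rightarrow>\<^sub>0 nat) set \<Rightarrow> ((nat \<Rightarrow>\<^sub>0 nat) \<Rightarrow> 'k::field) \<Rightarrow> 'k mpol" where
  "mpol_of M c = (\<Sum>m\<in>M. Poly_Mapping.single m (c m))"

lemma lookup_mpol_of:
  assumes "finite M"
  shows "Poly_Mapping.lookup (mpol_of M c) m = (if m \<in> M then c m else 0)"
  unfolding mpol_of_def using assms by (simp add: lookup_sum lookup_single when_def)

lemma keys_mpol_of: "finite M \<Longrightarrow> Poly_Mapping.keys (mpol_of M c) \<subseteq> M"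
  by (auto simp: in_keys_iff lookup_mpol_of split: if_splits)

lemma eval_mpol_of:
  assumes "finite M"
  shows "eval_mpol x (mpol_of M c) = (\<Sum>m\<in>M. c m * mon m x)"
  by (subst eval_mpol_superset[OF assms keys_mpol_of[OF assms]])
     (auto intro: sum.cong simp: lookup_mpol_of assms)

section \<open>Exponent vectors in a box\<close>

definition box :: "nat set \<Rightarrow> nat \<Rightarrow> (nat \<Rightarrow>\<^sub>0 nat) set" where
  "box F d = {m. Poly_Mapping.keys m \<subseteq> F \<and> (\<forall>i. Poly_Mapping.lookup m i \<le> d)}"

lemma box_mono: "F \<subseteq> F' \<Longrightarrow> d \<le> d' \<Longrightarrow> box F d \<subseteq> box F' d'"
  by (auto simp: box_def) (meson le_trans)

lemma box_add: "m \<in> box F d \<Longrightarrow> m' \<in> box F d' \<Longrightarrow> m + m' \<in> box F (d + d')"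
  using keys_add[of m m'] by (auto simp: box_def lookup_add intro: add_mono)

lemma box_bij:
  assumes "finite F"
  shows "bij_betw (\<lambda>m. restrict (Poly_Mapping.lookup m) F) (box F d) (F \<rightarrow>\<^sub>E {..d})"
proof (rule bij_betwI')
  fix m m' assume "m \<in> box F d" "m' \<in> box F d"
  then have "Poly_Mapping.lookup m i = 0 \<and> Poly_Mapping.lookup m' i = 0" if "i \<notin> F" for i
    using that by (auto simp: box_def in_keys_iff)
  then show "(restrict (Poly_Mapping.lookup m) F = restrict (Poly_Mapping.lookup m') F) = (m = m')"
    by (metis poly_mapping_eqI restrict_apply')
next
  fix g assume g: "g \<in> F \<rightarrow>\<^sub>E {..d}"
  define m where "m = Abs_poly_mapping (\<lambda>i. if i \<in> F then g i else 0)"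
  have "finite {i. (if i \<in> F then g i else 0) \<noteq> 0}"
    using assms by (rule rev_finite_subset) auto
  then have lk: "Poly_Mapping.lookup m = (\<lambda>i. if i \<in> F then g i else 0)"
    unfolding m_def by (rule lookup_Abs_poly_mapping)
  have "m \<in> box F d" using g by (auto simp: box_def in_keys_iff lk split: if_splits)
  moreover have "g = restrict (Poly_Mapping.lookup m) F"
    using g by (auto simp: lk fun_eq_iff PiE_def extensional_def)
  ultimately show "\<exists>m\<in>box F d. g = restrict (Poly_Mapping.lookup m) F" by blast
qed (auto simp: box_def)

lemma finite_box: "finite F \<Longrightarrow> finite (box F d)"
  using bij_betw_finite[OF box_bij[of F d]] by (simp add: finite_PiE)

text \<open>Bounding each exponent separately, instead of the total degree, makes this count an
  exact power.\<close>

lemma card_box: "finite F \<Longrightarrow> card (box F d) = (d + 1) ^ card F"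
  using bij_betw_same_card[OF box_bij[of F d]] by (simp add: card_PiE)

lemma finite_subset_box:
  assumes "finite M" "\<And>m. m \<in> M \<Longrightarrow> Poly_Mapping.keys m \<subseteq> F"
  obtains d where "M \<subseteq> box F d"
proof
  show "M \<subseteq> box F (\<Sum>m\<in>M. \<Sum>i\<in>Poly_Mapping.keys m. Poly_Mapping.lookup m i)"
  proof
    fix m assume m: "m \<in> M"
    have "Poly_Mapping.lookup m i \<le> (\<Sum>m\<in>M. \<Sum>i\<in>Poly_Mapping.keys m. Poly_Mapping.lookup m i)" for i
    proof (cases "i \<in> Poly_Mapping.keys m")
      case True
      then have "Poly_Mapping.lookup m i \<le> (\<Sum>i\<in>Poly_Mapping.keys m. Poly_Mapping.lookup m i)"
        by (intro member_le_sum) auto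
      also have "\<dots> \<le> (\<Sum>m\<in>M. \<Sum>i\<in>Poly_Mapping.keys m. Poly_Mapping.lookup m i)"
        using m assms(1) by (intro member_le_sum) auto
      finally show ?thesis .
    qed (simp add: in_keys_iff)
    then show "m \<in> box F (\<Sum>m\<in>M. \<Sum>i\<in>Poly_Mapping.keys m. Poly_Mapping.lookup m i)"
      using m assms(2) by (auto simp: box_def)
  qed
qed

text \<open>Functions rather than polynomials: passing to the quotient by the vanishing ideal of a
  set is then mere restriction to that set.\<close>

definition bpoly :: "nat set \<Rightarrow> nat \<Rightarrow> ((nat \<Rightarrow> 'k::field) \<Rightarrow> 'k) set" where
  "bpoly F d = {f. \<exists>c. f = (\<lambda>x. \<Sum>m\<in>box F d. c m * mon m x)}"

definition polyfun :: "nat set \<Rightarrow> ((nat \<Rightarrow> 'k::field) \<Rightarrow> 'k) set" where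
  "polyfun F = (\<Union>d. bpoly F d)"

lemma bpolyI: "(\<And>x. f x = (\<Sum>m\<in>box F d. c m * mon m x)) \<Longrightarrow> f \<in> bpoly F d"
  by (auto simp: bpoly_def fun_eq_iff)

lemma bpoly_add:
  assumes "f \<in> bpoly F d" "g \<in> bpoly F d"
  shows "(\<lambda>x. f x + g x) \<in> bpoly F d"
proof -
  obtain c c' where "f = (\<lambda>x. \<Sum>m\<in>box F d. c m * mon m x)" "g = (\<lambda>x. \<Sum>m\<in>box F d. c' m * mon m x)"
    using assms by (auto simp: bpoly_def)
  then show ?thesis
    by (intro bpolyI[where c = "\<lambda>m. c m + c' m"]) (simp add: sum.distrib algebra_simps)
qed

lemma bpoly_scale:
  assumes "f \<in> bpoly F d"
  shows "(\<lambda>x. a * f x) \<in> bpoly F d"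
proof -
  obtain c where "f = (\<lambda>x. \<Sum>m\<in>box F d. c m * mon m x)"
    using assms by (auto simp: bpoly_def)
  then show ?thesis
    by (intro bpolyI[where c = "\<lambda>m. a * c m"]) (simp add: sum_distrib_left algebra_simps)
qed

lemma bpoly_0: "(\<lambda>x. 0) \<in> bpoly F d"
  unfolding bpoly_def by (auto intro!: exI[of _ "\<lambda>_. 0"])

lemma bpoly_sum:
  assumes "\<And>a. a \<in> A \<Longrightarrow> g a \<in> bpoly F d"
  shows "(\<lambda>x. \<Sum>a\<in>A. g a x) \<in> bpoly F d"
  using assms by (induction A rule: infinite_finite_induct) (auto intro: bpoly_0 bpoly_add)

lemma bpoly_mon:
  assumes "finite F" "m \<in> box F d"
  shows "mon m \<in> bpoly F d"
  using assms finite_box[OF assms(1), of d]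
  by (intro bpolyI[where c = "\<lambda>m'. if m' = m then 1 else 0"])
     (simp add: if_distrib[of "\<lambda>u. u * _"] cong: if_cong)

lemma bpoly_const: "finite F \<Longrightarrow> (\<lambda>x. a) \<in> bpoly F d"
  using bpoly_scale[OF bpoly_mon[of F 0 d], of a] by (simp add: box_def)

lemma bpoly_var:
  assumes "finite F" "i \<in> F" "0 < d"
  shows "(\<lambda>x. x i) \<in> bpoly F d"
proof -
  have "Poly_Mapping.single i 1 \<in> box F d"
    using assms by (auto simp: box_def lookup_single when_def)
  from bpoly_mon[OF assms(1) this] show ?thesis by (simp add: mon_single[abs_def])
qed

lemma bpoly_mono:
  assumes "finite F'" "F \<subseteq> F'" "d \<le> d'"
  shows "bpoly F d \<subseteq> bpoly F' d'"
proof
  fix f :: "(nat \<Rightarrow> 'a) \<Rightarrow> 'a" assume "f \<in> bpoly F d"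
  then obtain c where f: "f = (\<lambda>x. \<Sum>m\<in>box F d. c m * mon m x)" by (auto simp: bpoly_def)
  show "f \<in> bpoly F' d'" unfolding f
    using box_mono[OF assms(2,3)] by (intro bpoly_sum bpoly_scale bpoly_mon assms) auto
qed

lemma bpoly_mult:
  assumes "finite F" "f \<in> bpoly F d" "g \<in> bpoly F d'"
  shows "(\<lambda>x. f x * g x) \<in> bpoly F (d + d')"
proof -
  obtain c c' where f: "f = (\<lambda>x. \<Sum>m\<in>box F d. c m * mon m x)" and g: "g = (\<lambda>x. \<Sum>m\<in>box F d'. c' m * mon m x)"
    using assms(2,3) by (auto simp: bpoly_def)
  have "(\<lambda>x. f x * g x) = (\<lambda>x. \<Sum>m\<in>box F d. \<Sum>m'\<in>box F d'. c m * (c' m' * mon (m + m') x))"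
    unfolding f g sum_product mon_add by (intro ext sum.cong refl) (simp add: mult_ac)
  then show ?thesis
    by (auto intro!: bpoly_sum bpoly_scale bpoly_mon assms(1) box_add)
qed

lemma bpoly_prod:
  assumes "finite F" "\<And>a. a \<in> A \<Longrightarrow> g a \<in> bpoly F (e a)"
  shows "(\<lambda>x. \<Prod>a\<in>A. g a x) \<in> bpoly F (\<Sum>a\<in>A. e a)"
  using assms(2)
proof (induction A rule: infinite_finite_induct)
  case (insert a A)
  from bpoly_mult[OF assms(1) insert.prems[OF insertI1] insert.IH] insert.prems insert.hyps
  show ?case by simp
qed (use bpoly_const[OF assms(1)] in auto)

lemma bpoly_power:
  assumes "finite F" "g \<in> bpoly F d"
  shows "(\<lambda>x. g x ^ k) \<in> bpoly F (k * d)"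
proof (induction k)
  case (Suc k)
  from bpoly_mult[OF assms this] show ?case by simp
qed (simp add: bpoly_const[OF assms(1)])

text \<open>Each of the \<open>card A\<close> factors is a power, with exponent at most
  \<open>d\<close>, of a function of degree \<open>e\<close>. What matters later is that the bound
  is linear in \<open>d\<close>.\<close>

lemma bpoly_mon_comp:
  assumes "finite F" "finite A" "m \<in> box A d" "\<And>i. i \<in> A \<Longrightarrow> g i \<in> bpoly F e"
  shows "(\<lambda>x. mon m (\<lambda>i. if i \<in> A then g i x else 0)) \<in> bpoly F (card A * (d * e))"
proof -
  have "(\<lambda>x. mon m (\<lambda>i. if i \<in> A then g i x else 0)) = (\<lambda>x. \<Prod>i\<in>A. g i x ^ Poly_Mapping.lookup m i)"
    using assms(2,3) by (auto simp: mon_superset[of A] box_def intro!: prod.cong)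
  moreover have "(\<lambda>x. \<Prod>i\<in>A. g i x ^ Poly_Mapping.lookup m i) \<in> bpoly F (\<Sum>i\<in>A. d * e)"
  proof (rule bpoly_prod[OF assms(1)])
    fix i assume i: "i \<in> A"
    have "(\<lambda>x. g i x ^ Poly_Mapping.lookup m i) \<in> bpoly F (Poly_Mapping.lookup m i * e)"
      by (intro bpoly_power assms i)
    moreover have "Poly_Mapping.lookup m i * e \<le> d * e" using assms(3) by (auto simp: box_def)
    ultimately show "(\<lambda>x. g i x ^ Poly_Mapping.lookup m i) \<in> bpoly F (d * e)"
      using bpoly_mono[OF assms(1) order_refl] by blast
  qed
  ultimately show ?thesis by simp
qed

section \<open>Polynomial functions of unspecified degree\<close>

lemma bpoly_polyfun: "f \<in> bpoly F d \<Longrightarrow> f \<in> polyfun F"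
  by (auto simp: polyfun_def)

lemma polyfun_eval:
  assumes "finite F" "p \<in> poly_ring F"
  shows "(\<lambda>x. eval_mpol x p) \<in> polyfun F"
proof -
  obtain d where d: "Poly_Mapping.keys p \<subseteq> box F d"
    using finite_subset_box[of "Poly_Mapping.keys p" F] assms(2) by (auto simp: poly_ring_def)
  have "(\<lambda>x. eval_mpol x p) \<in> bpoly F d"
    by (rule bpolyI) (rule eval_mpol_superset[OF finite_box[OF assms(1)] d])
  then show ?thesis by (rule bpoly_polyfun)
qed

lemma mpol_of_box_in_poly_ring: "finite F \<Longrightarrow> mpol_of (box F d) c \<in> poly_ring F"
  using keys_mpol_of[OF finite_box, of F d c] by (auto simp: poly_ring_def box_def)

lemma polyfunE:
  assumes "finite F" "f \<in> polyfun F"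
  obtains p where "p \<in> poly_ring F" "f = (\<lambda>x. eval_mpol x p)"
proof -
  obtain d c where "f = (\<lambda>x. \<Sum>m\<in>box F d. c m * mon m x)"
    using assms(2) by (auto simp: polyfun_def bpoly_def)
  then have "f = (\<lambda>x. eval_mpol x (mpol_of (box F d) c))"
    by (simp add: eval_mpol_of finite_box assms(1) fun_eq_iff)
  from that[OF mpol_of_box_in_poly_ring[OF assms(1)] this] show ?thesis .
qed

lemma polyfun_mono: "finite F' \<Longrightarrow> F \<subseteq> F' \<Longrightarrow> polyfun F \<subseteq> polyfun F'"
  unfolding polyfun_def by (rule UN_mono[OF order_refl bpoly_mono[OF _ _ order_refl]])

lemma polyfun_mult:
  assumes "finite F" "f \<in> polyfun F" "g \<in> polyfun F"
  shows "(\<lambda>x. f x * g x) \<in> polyfun F"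
proof -
  obtain d e where "f \<in> bpoly F d" "g \<in> bpoly F e" using assms(2,3) by (auto simp: polyfun_def)
  from bpoly_polyfun[OF bpoly_mult[OF assms(1) this]] show ?thesis .
qed

lemma polyfun_common_degree:
  assumes "finite F" "finite A" "\<And>a. a \<in> A \<Longrightarrow> g a \<in> polyfun F"
  obtains D where "\<And>a. a \<in> A \<Longrightarrow> g a \<in> bpoly F D"
proof -
  obtain e where e: "\<And>a. a \<in> A \<Longrightarrow> g a \<in> bpoly F (e a)"
    using assms(3) unfolding polyfun_def UN_iff by metis
  have "g a \<in> bpoly F (\<Sum>a\<in>A. e a)" if "a \<in> A" for a
  proof -
    have "e a \<le> (\<Sum>a\<in>A. e a)" using that assms(2) by (intro member_le_sum) auto
    then show ?thesis by (rule subsetD[OF bpoly_mono[OF assms(1) order_refl] e[OF that]])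
  qed
  then show ?thesis by (rule that)
qed

lemma polyfun_cong:
  assumes "finite F" "f \<in> polyfun F" "\<And>i. i \<in> F \<Longrightarrow> x i = y i"
  shows "f x = f y"
  using polyfunE[OF assms(1,2)] eval_mpol_cong[of _ F x y] assms(3) by metis

text \<open>The image of the tensor square of \<open>bpoly F d\<close> in the functions of two
  points, generated inductively so that no basis has to be chosen.\<close>

inductive_set tens :: "nat set \<Rightarrow> nat \<Rightarrow> ((nat \<Rightarrow> 'k::field) \<Rightarrow> (nat \<Rightarrow> 'k) \<Rightarrow> 'k) set"
  for F d where
  prod: "u \<in> bpoly F d \<Longrightarrow> v \<in> bpoly F d \<Longrightarrow> (\<lambda>x y. u x * v y) \<in> tens F d"
| add: "H \<in> tens F d \<Longrightarrow> H' \<in> tens F d \<Longrightarrow> (\<lambda>x y. H x y + H' x y) \<in> tens F d"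

lemma tens_mono:
  assumes "finite F" "d \<le> d'" "H \<in> tens F d"
  shows "H \<in> tens F d'"
  using assms(3)
proof induction
  case (prod u v)
  then show ?case
    by (intro tens.prod) (rule subsetD[OF bpoly_mono[OF assms(1) order_refl assms(2)]]; assumption)+
qed (rule tens.add)

lemma tens_mult:
  assumes "finite F" "H \<in> tens F d" "H' \<in> tens F d'"
  shows "(\<lambda>x y. H x y * H' x y) \<in> tens F (d + d')"
  using assms(2)
proof induction
  case (prod u v)
  show ?case using assms(3)
  proof induction
    case (prod u' v')
    have "(\<lambda>x y. (u x * u' x) * (v y * v' y)) \<in> tens F (d + d')"
      by (intro tens.prod bpoly_mult assms(1) prod \<open>u \<in> _\<close> \<open>v \<in> _\<close>)
    then show ?case by (simp add: mult_ac)
  next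
    case (add H1 H2)
    from tens.add[OF add.IH] show ?case by (simp add: distrib_left)
  qed
next
  case (add H1 H2)
  from tens.add[OF add.IH] show ?case by (simp add: distrib_right)
qed

lemma tens_const: "finite F \<Longrightarrow> (\<lambda>x y. a) \<in> tens F d"
  using tens.prod[of "\<lambda>_. a" F d "\<lambda>_. 1"] by (simp add: bpoly_const)

lemma tens_prod:
  assumes "finite F" "\<And>a. a \<in> A \<Longrightarrow> H a \<in> tens F (e a)"
  shows "(\<lambda>x y. \<Prod>a\<in>A. H a x y) \<in> tens F (\<Sum>a\<in>A. e a)"
  using assms(2)
proof (induction A rule: infinite_finite_induct)
  case (insert a A)
  from tens_mult[OF assms(1) insert.prems[OF insertI1] insert.IH] insert.prems insert.hyps
  show ?case by simp
qed (use tens_const[OF assms(1)] in auto)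

lemma tens_sum:
  assumes "finite F" "\<And>a. a \<in> A \<Longrightarrow> H a \<in> tens F d"
  shows "(\<lambda>x y. \<Sum>a\<in>A. H a x y) \<in> tens F d"
  using assms(2)
proof (induction A rule: infinite_finite_induct)
  case (insert a A)
  from tens.add[OF insert.prems[OF insertI1] insert.IH] insert.prems insert.hyps
  show ?case by simp
qed (use tens_const[OF assms(1)] in auto)

lemma tens_power:
  assumes "finite F" "H \<in> tens F d"
  shows "(\<lambda>x y. H x y ^ k) \<in> tens F (k * d)"
proof (induction k)
  case (Suc k)
  from tens_mult[OF assms this] show ?case by simp
qed (simp add: tens_const[OF assms(1)])

text \<open>\<open>x i + y i\<close> is a sum of two pure products, so its power in a monomial has
  degree at most \<open>d\<close> in either point; the \<open>card F\<close> coordinates contribute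
  one such power each.\<close>

lemma bpoly_shift_tens:
  fixes f :: "(nat \<Rightarrow> 'k::field) \<Rightarrow> 'k"
  assumes F: "finite F" and f: "f \<in> bpoly F d"
  shows "(\<lambda>x y. f (\<lambda>i. x i + y i)) \<in> tens F (card F * d)"
proof -
  have mon: "(\<lambda>x y. mon m (\<lambda>i. x i + y i :: 'k)) \<in> tens F (card F * d)" if m: "m \<in> box F d" for m
  proof -
    have "(\<lambda>x y. \<Prod>i\<in>F. (x i + y i :: 'k) ^ Poly_Mapping.lookup m i) \<in> tens F (\<Sum>i\<in>F. d)"
    proof (rule tens_prod[OF F])
      fix i assume i: "i \<in> F"
      have "(\<lambda>x y. x i * 1 + 1 * y i) \<in> tens F 1"
        by (intro tens.intros bpoly_var bpoly_const F i) auto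
      then have "(\<lambda>x y. (x i + y i) ^ Poly_Mapping.lookup m i) \<in> tens F (Poly_Mapping.lookup m i * 1)"
        by (intro tens_power F) simp
      then show "(\<lambda>x y. (x i + y i) ^ Poly_Mapping.lookup m i) \<in> tens F d"
        by (rule tens_mono[OF F, rotated]) (use m in \<open>auto simp: box_def\<close>)
    qed
    moreover have "mon m z = (\<Prod>i\<in>F. z i ^ Poly_Mapping.lookup m i)" for z :: "nat \<Rightarrow> 'k"
      using m by (intro mon_superset F) (auto simp: box_def)
    ultimately show ?thesis by simp
  qed
  obtain c where f: "f = (\<lambda>x. \<Sum>m\<in>box F d. c m * mon m x)" using f by (auto simp: bpoly_def)
  have "(\<lambda>x y. c m * mon m (\<lambda>i. x i + y i)) \<in> tens F (card F * d)" if "m \<in> box F d" for m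
    using tens_mult[OF F tens_const[OF F, of "c m" 0] mon[OF that]] by simp
  then show ?thesis unfolding f by (rule tens_sum[OF F])
qed

lemma tens_bpoly:
  assumes "H \<in> tens F d"
  shows "(\<lambda>x. H x y) \<in> bpoly F d" "(\<lambda>x. H y x) \<in> bpoly F d"
proof -
  show "(\<lambda>x. H x y) \<in> bpoly F d"
    using assms
  proof induction
    case (prod u v)
    from bpoly_scale[OF prod(1), of "v y"] show ?case by (simp add: mult.commute)
  qed (rule bpoly_add)
  show "(\<lambda>x. H y x) \<in> bpoly F d"
    using assms by induction (rule bpoly_scale bpoly_add; assumption)+
qed

lemma polyfun_shift:
  assumes "finite F" "f \<in> polyfun F"
  shows "(\<lambda>x. f (\<lambda>i. x i + y i)) \<in> polyfun F" "(\<lambda>x. f (\<lambda>i. y i + x i)) \<in> polyfun F"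
proof -
  obtain d where d: "f \<in> bpoly F d" using assms(2) by (auto simp: polyfun_def)
  show "(\<lambda>x. f (\<lambda>i. x i + y i)) \<in> polyfun F" "(\<lambda>x. f (\<lambda>i. y i + x i)) \<in> polyfun F"
    by (rule bpoly_polyfun, rule tens_bpoly[OF bpoly_shift_tens[OF assms(1) d]])+
qed

section \<open>Algebraic independence and growth\<close>

definition indep_on :: "(nat \<Rightarrow> 'k::field) set \<Rightarrow> nat set \<Rightarrow> bool" where
  "indep_on S F \<longleftrightarrow> (\<forall>p\<in>poly_ring F. (\<forall>x\<in>S. eval_mpol x p = 0) \<longrightarrow> p = 0)"

text \<open>No inclusion between the two sets is demanded, so that a set and its coordinate
  projection can be dense in each other.\<close>

definition dense_in :: "nat set \<Rightarrow> (nat \<Rightarrow> 'k::field) set \<Rightarrow> (nat \<Rightarrow> 'k) set \<Rightarrow> bool" where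
  "dense_in F S' S \<longleftrightarrow> (\<forall>f\<in>polyfun F. (\<forall>x\<in>S'. f x = 0) \<longrightarrow> (\<forall>x\<in>S. f x = 0))"

text \<open>The ring of polynomial functions restricted to \<open>S\<close> is an integral domain.
  The notion must cover sets of sums, which need not be closed.\<close>

definition irreducible_on :: "nat set \<Rightarrow> (nat \<Rightarrow> 'k::field) set \<Rightarrow> bool" where
  "irreducible_on F S \<longleftrightarrow> S \<noteq> {} \<and>
     (\<forall>f\<in>polyfun F. \<forall>g\<in>polyfun F. (\<forall>x\<in>S. f x * g x = 0) \<longrightarrow>
        (\<forall>x\<in>S. f x = 0) \<or> (\<forall>x\<in>S. g x = 0))"

definition plus_set :: "(nat \<Rightarrow> 'k::field) set \<Rightarrow> (nat \<Rightarrow> 'k) set \<Rightarrow> (nat \<Rightarrow> 'k) set" where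
  "plus_set S T = {(\<lambda>i. x i + y i) |x y. x \<in> S \<and> y \<in> T}"

text \<open>A dimension bound for \<open>V\<close> restricted to \<open>S\<close>. The spanning
  functions \<open>h\<close> are arbitrary, because quotients and functions of a chosen
  decomposition will occur among them.\<close>

definition spanned :: "('a \<Rightarrow> 'k::field) set \<Rightarrow> 'a set \<Rightarrow> nat \<Rightarrow> bool" where
  "spanned V S n \<longleftrightarrow> (\<exists>h. \<forall>f\<in>V. \<exists>\<gamma>. \<forall>x\<in>S. f x = (\<Sum>t<n. \<gamma> t * h t x))"

text \<open>
  Passing to a dense subset of \<open>S\<close> allows pointwise division by a polynomial function that does not
  vanish identically on \<open>S\<close>, which takes the place of localization.
\<close>

definition growth :: "nat set \<Rightarrow> (nat \<Rightarrow> 'k::field) set \<Rightarrow> nat set \<Rightarrow> nat \<Rightarrow> bool" where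
  "growth Z S F r \<longleftrightarrow>
     (\<exists>S'\<subseteq>S. dense_in Z S' S \<and> (\<exists>C c. \<forall>d. spanned (bpoly F d) S' (C * (c * d + 1) ^ r)))"

lemma dense_inD: "dense_in F S' S \<Longrightarrow> f \<in> polyfun F \<Longrightarrow> (\<And>x. x \<in> S' \<Longrightarrow> f x = 0) \<Longrightarrow> x \<in> S \<Longrightarrow> f x = 0"
  unfolding dense_in_def by blast

lemma spannedI:
  fixes h :: "'t \<Rightarrow> 'a \<Rightarrow> 'k::field"
  assumes "finite T" "card T \<le> n" "\<And>f. f \<in> V \<Longrightarrow> \<exists>\<gamma>. \<forall>x\<in>S. f x = (\<Sum>t\<in>T. \<gamma> t * h t x)"
  shows "spanned V S n"
proof -
  obtain \<sigma> where bij: "bij_betw \<sigma> {..<card T} T"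
    using ex_bij_betw_nat_finite[OF assms(1)] by (auto simp: atLeast0LessThan)
  \<comment> \<open>Zero functions fill up the number \<open>n\<close> when \<open>T\<close> is
    smaller.\<close>
  define h' where "h' = (\<lambda>t. if t < card T then h (\<sigma> t) else (\<lambda>_. 0))"
  have "\<exists>\<gamma>. \<forall>x\<in>S. f x = (\<Sum>t<n. \<gamma> t * h' t x)" if f: "f \<in> V" for f
  proof -
    obtain \<gamma> where \<gamma>: "\<And>x. x \<in> S \<Longrightarrow> f x = (\<Sum>t\<in>T. \<gamma> t * h t x)"
      using assms(3)[OF f] by blast
    have "f x = (\<Sum>t<n. \<gamma> (\<sigma> t) * h' t x)" if "x \<in> S" for x
    proof -
      have "(\<Sum>t<n. \<gamma> (\<sigma> t) * h' t x) = (\<Sum>t<card T. \<gamma> (\<sigma> t) * h (\<sigma> t) x)"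
        using assms(2) by (intro sum.mono_neutral_cong_right) (auto simp: h'_def)
      also have "\<dots> = (\<Sum>t\<in>T. \<gamma> t * h t x)"
        by (rule sum.reindex_bij_betw[OF bij])
      finally show ?thesis using \<gamma>[OF that] by simp
    qed
    then show ?thesis by (intro exI[of _ "\<lambda>t. \<gamma> (\<sigma> t)"] ballI)
  qed
  then show ?thesis unfolding spanned_def by (intro exI[of _ h'] ballI)
qed

lemma spanned_bpolyI:
  fixes h :: "'t \<Rightarrow> (nat \<Rightarrow> 'k::field) \<Rightarrow> 'k"
  assumes "finite T" "card T \<le> n"
    and mon: "\<And>m. m \<in> box F d \<Longrightarrow> \<exists>\<gamma>. \<forall>x\<in>S. mon m x = (\<Sum>t\<in>T. \<gamma> t * h t x)"
  shows "spanned (bpoly F d) S n"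
proof (rule spannedI[OF assms(1,2)])
  fix f :: "(nat \<Rightarrow> 'k) \<Rightarrow> 'k" assume "f \<in> bpoly F d"
  then obtain c where f: "f = (\<lambda>x. \<Sum>m\<in>box F d. c m * mon m x)" by (auto simp: bpoly_def)
  have "\<exists>\<gamma>. \<forall>m\<in>box F d. \<forall>x\<in>S. mon m x = (\<Sum>t\<in>T. \<gamma> m t * h t x)"
    using mon by (intro bchoice) blast
  then obtain \<gamma> where \<gamma>: "\<And>m x. m \<in> box F d \<Longrightarrow> x \<in> S \<Longrightarrow> mon m x = (\<Sum>t\<in>T. \<gamma> m t * h t x)" by blast
  have "f x = (\<Sum>t\<in>T. (\<Sum>m\<in>box F d. c m * \<gamma> m t) * h t x)" if "x \<in> S" for x
  proof -
    have "f x = (\<Sum>m\<in>box F d. \<Sum>t\<in>T. c m * \<gamma> m t * h t x)"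
      unfolding f using \<gamma> that by (intro sum.cong refl) (simp add: sum_distrib_left mult.assoc)
    also have "\<dots> = (\<Sum>t\<in>T. (\<Sum>m\<in>box F d. c m * \<gamma> m t) * h t x)"
      by (subst sum.swap) (simp add: sum_distrib_right)
    finally show ?thesis .
  qed
  then show "\<exists>\<gamma>. \<forall>x\<in>S. f x = (\<Sum>t\<in>T. \<gamma> t * h t x)"
    by (intro exI[of _ "\<lambda>t. \<Sum>m\<in>box F d. c m * \<gamma> m t"] ballI)
qed

section \<open>Linear relations by counting\<close>

lemma homogeneous_system:
  fixes c :: "'j \<Rightarrow> nat \<Rightarrow> 'k::field"
  assumes "finite J" "n < card J"
  shows "\<exists>b. (\<exists>j\<in>J. b j \<noteq> 0) \<and> (\<forall>t<n. (\<Sum>j\<in>J. b j * c j t) = 0)"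
  using assms
proof (induction n arbitrary: J c)
  case 0
  then have "J \<noteq> {}" by auto
  then show ?case by (intro exI[of _ "\<lambda>_. 1"]) auto
next
  case (Suc n)
  show ?case
  proof (cases "\<forall>j\<in>J. c j n = 0")
    case True
    from Suc.IH[of J c] Suc.prems obtain b
      where "\<exists>j\<in>J. b j \<noteq> 0" "\<forall>t<n. (\<Sum>j\<in>J. b j * c j t) = 0" by auto
    with True show ?thesis by (intro exI[of _ b]) (auto simp: less_Suc_eq)
  next
    case False
    then obtain j0 where j0: "j0 \<in> J" "c j0 n \<noteq> 0" by blast
    \<comment> \<open>Equation \<open>n\<close> is solved for the unknown \<open>j0\<close> and
      substituted into the others; \<open>c'\<close> is the system that remains in the other
      unknowns.\<close>
    define c' where "c' j t = c j t - c j n / c j0 n * c j0 t" for j t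
    have "n < card (J - {j0})" using Suc.prems j0(1) by simp
    from Suc.IH[OF _ this, of c'] Suc.prems(1) obtain b
      where b: "\<exists>j\<in>J - {j0}. b j \<noteq> 0" "\<And>t. t < n \<Longrightarrow> (\<Sum>j\<in>J - {j0}. b j * c' j t) = 0" by auto
    define \<beta> where "\<beta> = - ((\<Sum>j\<in>J - {j0}. b j * c j n) / c j0 n)"
    have "(\<Sum>j\<in>J. (b(j0 := \<beta>)) j * c j t) = \<beta> * c j0 t + (\<Sum>j\<in>J - {j0}. b j * c j t)" for t
      using Suc.prems(1) j0(1) by (subst sum.remove[of _ j0]) (auto intro!: sum.cong)
    moreover have "(\<Sum>j\<in>J - {j0}. b j * c' j t) = \<beta> * c j0 t + (\<Sum>j\<in>J - {j0}. b j * c j t)" for t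
    proof -
      have "(\<Sum>j\<in>J - {j0}. b j * c' j t)
          = (\<Sum>j\<in>J - {j0}. b j * c j t) - (\<Sum>j\<in>J - {j0}. b j * c j n * (c j0 t / c j0 n))"
        by (simp add: c'_def right_diff_distrib sum_subtractf mult.assoc)
      then show ?thesis by (simp add: \<beta>_def sum_distrib_right sum_divide_distrib)
    qed
    moreover have "\<beta> * c j0 n + (\<Sum>j\<in>J - {j0}. b j * c j n) = 0"
      using j0(2) by (simp add: \<beta>_def)
    ultimately have "\<forall>t<Suc n. (\<Sum>j\<in>J. (b(j0 := \<beta>)) j * c j t) = 0"
      using b(2) by (auto simp: less_Suc_eq)
    moreover have "\<exists>j\<in>J. (b(j0 := \<beta>)) j \<noteq> 0" using b(1) by auto
    ultimately show ?thesis by blast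
  qed
qed

lemma spanned_dependent:
  fixes g :: "'j \<Rightarrow> 'a \<Rightarrow> 'k::field"
  assumes "spanned V S n" "finite J" "n < card J" "\<And>j. j \<in> J \<Longrightarrow> g j \<in> V"
  shows "\<exists>b. (\<exists>j\<in>J. b j \<noteq> 0) \<and> (\<forall>x\<in>S. (\<Sum>j\<in>J. b j * g j x) = 0)"
proof -
  obtain h where "\<forall>f\<in>V. \<exists>\<gamma>. \<forall>x\<in>S. f x = (\<Sum>t<n. \<gamma> t * h t x)"
    using assms(1) unfolding spanned_def by blast
  with assms(4) have "\<forall>j\<in>J. \<exists>\<gamma>. \<forall>x\<in>S. g j x = (\<Sum>t<n. \<gamma> t * h t x)" by blast
  from bchoice[OF this] obtain c where c: "\<And>j x. j \<in> J \<Longrightarrow> x \<in> S \<Longrightarrow> g j x = (\<Sum>t<n. c j t * h t x)"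
    by blast
  obtain b where b: "\<exists>j\<in>J. b j \<noteq> 0" "\<And>t. t < n \<Longrightarrow> (\<Sum>j\<in>J. b j * c j t) = 0"
    using homogeneous_system[OF assms(2,3), of c] by blast
  have "(\<Sum>j\<in>J. b j * g j x) = 0" if "x \<in> S" for x
  proof -
    have "(\<Sum>j\<in>J. b j * g j x) = (\<Sum>j\<in>J. \<Sum>t<n. b j * c j t * h t x)"
      using c that by (intro sum.cong refl) (simp add: sum_distrib_left mult.assoc)
    also have "\<dots> = (\<Sum>t<n. (\<Sum>j\<in>J. b j * c j t) * h t x)"
      by (subst sum.swap) (simp add: sum_distrib_right)
    finally show ?thesis using b(2) by simp
  qed
  with b(1) show ?thesis by (intro exI[of _ b] conjI ballI)
qed

section \<open>Upper and lower bounds for growth\<close>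

lemma growth_base:
  assumes "finite F"
  shows "growth Z S F (card F)"
proof -
  have "spanned (bpoly F d) S (1 * (1 * d + 1) ^ card F)" for d
  proof (rule spanned_bpolyI[where T = "box F d" and h = mon])
    fix m assume "m \<in> box F d"
    then show "\<exists>\<gamma>. \<forall>x\<in>S. mon m x = (\<Sum>t\<in>box F d. \<gamma> t * mon t x)"
      using finite_box[OF assms]
      by (intro exI[of _ "\<lambda>t. if t = m then 1 else 0"]) (simp add: if_distrib[of "\<lambda>u. u * _"] cong: if_cong)
  qed (use assms in \<open>auto simp: finite_box card_box\<close>)
  moreover have "dense_in Z S S" by (simp add: dense_in_def)
  ultimately show ?thesis unfolding growth_def by blast
qed

lemma polynomial_growth_less:
  fixes C c r k :: nat
  assumes "r < k"
  obtains d where "C * (c * d + 1) ^ r < (d + 1) ^ k"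
proof -
  \<comment> \<open>With this choice the constant C(c+1)^r of the upper estimate equals
    \<open>d\<close> and loses against one further factor \<open>d + 1\<close>.\<close>
  define d where "d = C * (c + 1) ^ r"
  have "C * (c * d + 1) ^ r \<le> C * ((c + 1) * (d + 1)) ^ r"
    by (intro mult_le_mono power_mono) auto
  also have "\<dots> = d * (d + 1) ^ r" by (simp only: d_def power_mult_distrib mult.assoc)
  also have "\<dots> < (d + 1) * (d + 1) ^ r" by simp
  also have "\<dots> = (d + 1) ^ Suc r" by simp
  also have "\<dots> \<le> (d + 1) ^ k" using assms by (intro power_increasing) auto
  finally show ?thesis by (rule that)
qed

text \<open>The monomials in the \<open>f i\<close> with exponents at most \<open>d\<close> have
  degree linear in \<open>d\<close> and number (d+1)^|A|. If |A| exceeded \<open>r\<close>, for some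
  \<open>d\<close> they would outnumber the available dimension, and a linear relation between them
  is an algebraic relation between the \<open>f i\<close>.\<close>

lemma growth_bound:
  assumes Z: "finite Z" "F \<subseteq> Z" and gr: "growth Z S F r"
    and A: "finite A" "\<And>i. i \<in> A \<Longrightarrow> f i \<in> polyfun F"
    and indep: "\<And>q. q \<in> poly_ring A \<Longrightarrow>
      (\<And>x. x \<in> S \<Longrightarrow> eval_mpol (\<lambda>i. if i \<in> A then f i x else 0) q = 0) \<Longrightarrow> q = 0"
  shows "card A \<le> r"
proof (rule ccontr)
  assume "\<not> card A \<le> r"
  then have less: "r < card A" by simp
  have F: "finite F" using Z finite_subset by blast
  obtain D where D: "\<And>i. i \<in> A \<Longrightarrow> f i \<in> bpoly F D"
    using polyfun_common_degree[OF F A(1), of f] A(2) by blast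
  obtain S' C c where S': "dense_in Z S' S" and sp: "\<And>d. spanned (bpoly F d) S' (C * (c * d + 1) ^ r)"
    using gr unfolding growth_def by blast
  \<comment> \<open>The factor \<open>card A * D\<close> anticipates the degree
    \<open>card A * (d * D)\<close> of a composed monomial.\<close>
  obtain d where d: "C * ((c * card A * D) * d + 1) ^ r < (d + 1) ^ card A"
    using polynomial_growth_less[OF less] by blast
  define g where "g m x = mon m (\<lambda>i. if i \<in> A then f i x else 0)" for m x
  have g: "g m \<in> bpoly F (card A * (d * D))" if "m \<in> box A d" for m
    unfolding g_def[abs_def] by (rule bpoly_mon_comp[OF F A(1) that D])
  have "C * (c * (card A * (d * D)) + 1) ^ r < card (box A d)"
    using d by (simp add: card_box A(1) mult_ac)
  then obtain b
    where b: "\<exists>m\<in>box A d. b m \<noteq> 0" "\<forall>x\<in>S'. (\<Sum>m\<in>box A d. b m * g m x) = 0"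
    using spanned_dependent[of "bpoly F (card A * (d * D))" S' _ "box A d" g, OF sp finite_box[OF A(1)]] g
    by blast
  have "(\<lambda>x. \<Sum>m\<in>box A d. b m * g m x) \<in> bpoly F (card A * (d * D))"
    by (intro bpoly_sum bpoly_scale g)
  then have "(\<lambda>x. \<Sum>m\<in>box A d. b m * g m x) \<in> polyfun Z"
    using polyfun_mono[OF Z] bpoly_polyfun by blast
  \<comment> \<open>The relation is a polynomial function, so it spreads from \<open>S'\<close> to
    all of \<open>S\<close>, where \<open>indep\<close> applies.\<close>
  from dense_inD[OF S' this bspec[OF b(2)]] have "(\<Sum>m\<in>box A d. b m * g m x) = 0" if "x \<in> S" for x
    using that by blast
  then have "mpol_of (box A d) b = 0"
    by (intro indep mpol_of_box_in_poly_ring A(1)) (simp add: eval_mpol_of finite_box A(1) g_def)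
  then have "b m = 0" if "m \<in> box A d" for m
    using lookup_mpol_of[OF finite_box[OF A(1)], of d b m] that by simp
  with b(1) show False by blast
qed

section \<open>Adjoining an algebraic coordinate\<close>

definition drop_var :: "nat \<Rightarrow> (nat \<Rightarrow>\<^sub>0 nat) \<Rightarrow> (nat \<Rightarrow>\<^sub>0 nat)" where
  "drop_var e m = m - Poly_Mapping.single e (Poly_Mapping.lookup m e)"

lemma lookup_drop_var: "Poly_Mapping.lookup (drop_var e m) i = (if i = e then 0 else Poly_Mapping.lookup m i)"
  by (auto simp: drop_var_def lookup_minus lookup_single when_def)

lemma drop_var_add: "drop_var e m + Poly_Mapping.single e (Poly_Mapping.lookup m e) = m"
  by (rule poly_mapping_eqI) (auto simp: lookup_add lookup_drop_var lookup_single when_def)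

lemma mon_drop_var: "mon m x = mon (drop_var e m) x * x e ^ Poly_Mapping.lookup m e"
  by (metis drop_var_add mon_add mon_single)

lemma keys_drop_var: "Poly_Mapping.keys (drop_var e m) = Poly_Mapping.keys m - {e}"
  by (auto simp: in_keys_iff lookup_drop_var split: if_splits)

lemma drop_var_box: "m \<in> box (insert e F) d \<Longrightarrow> drop_var e m \<in> box F d"
  by (auto simp: box_def keys_drop_var lookup_drop_var)

text \<open>A vanishing polynomial is sorted by powers of \<open>x e\<close>. Its top coefficient is
  a nonzero polynomial in the variables of \<open>F\<close>, so independence of \<open>F\<close>
  keeps it from vanishing on all of \<open>S\<close>.\<close>

lemma alg_relation:
  fixes S :: "(nat \<Rightarrow> 'k::field) set"
  assumes F: "finite F" and ind: "indep_on S F" and dep: "\<not> indep_on S (insert e F)"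
  obtains M a where "\<And>j. j \<le> M \<Longrightarrow> a j \<in> polyfun F" "\<exists>x\<in>S. a M x \<noteq> 0"
    "\<And>x. x \<in> S \<Longrightarrow> (\<Sum>j\<le>M. a j x * x e ^ j) = 0"
proof -
  obtain p where p: "p \<in> poly_ring (insert e F)" "\<And>x. x \<in> S \<Longrightarrow> eval_mpol x p = 0" "p \<noteq> 0"
    using dep unfolding indep_on_def by blast
  define K where "K = Poly_Mapping.keys p"
  define N where "N j = {m \<in> K. Poly_Mapping.lookup m e = j}" for j
  define P where "P j = mpol_of (drop_var e ` N j) (\<lambda>m. Poly_Mapping.lookup p (m + Poly_Mapping.single e j))" for j
  define M where "M = Max ((\<lambda>m. Poly_Mapping.lookup m e) ` K)"
  have K: "finite K" "K \<noteq> {}" using p(3) by (auto simp: K_def)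
  have N: "finite (N j)" for j using K(1) by (simp add: N_def)
  have restore: "drop_var e m + Poly_Mapping.single e j = m" if "m \<in> N j" for m j
    using that drop_var_add by (auto simp: N_def)
  \<comment> \<open>For a fixed exponent of \<open>e\<close> the other exponents determine the
    monomial, so no coefficients collide in \<open>P j\<close>.\<close>
  have inj: "inj_on (drop_var e) (N j)" for j
    by (rule inj_onI) (metis restore)
  have P: "P j \<in> poly_ring F" for j
    using keys_mpol_of[of "drop_var e ` N j"] N p(1)
    by (fastforce simp: P_def poly_ring_def N_def K_def keys_drop_var)
  have evP: "eval_mpol x (P j) = (\<Sum>m\<in>N j. Poly_Mapping.lookup p m * mon (drop_var e m) x)" for x j
    unfolding P_def by (simp add: eval_mpol_of N sum.reindex[OF inj] restore)
  have "eval_mpol x p = (\<Sum>j\<le>M. eval_mpol x (P j) * x e ^ j)" for x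
  proof -
    have "eval_mpol x p = (\<Sum>m\<in>K. Poly_Mapping.lookup p m * mon m x)"
      by (rule eval_mpol_superset) (auto simp: K_def)
    also have "\<dots> = (\<Sum>j\<le>M. \<Sum>m\<in>N j. Poly_Mapping.lookup p m * mon m x)"
      unfolding N_def by (rule sum.group[symmetric]) (use K in \<open>auto simp: M_def\<close>)
    also have "\<dots> = (\<Sum>j\<le>M. eval_mpol x (P j) * x e ^ j)"
      unfolding evP sum_distrib_right
      by (intro sum.cong refl) (subst mon_drop_var[of _ _ e], auto simp: N_def mult.assoc)
    finally show ?thesis .
  qed
  with p(2) have rel: "(\<Sum>j\<le>M. eval_mpol x (P j) * x e ^ j) = 0" if "x \<in> S" for x
    using that by simp
  have "M \<in> (\<lambda>m. Poly_Mapping.lookup m e) ` K" unfolding M_def using K by (intro Max_in) auto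
  then obtain m where m: "m \<in> N M" by (auto simp: N_def)
  then have "Poly_Mapping.lookup (P M) (drop_var e m) = Poly_Mapping.lookup p m"
    by (simp add: P_def lookup_mpol_of N restore)
  also have "\<dots> \<noteq> 0" using m by (auto simp: N_def K_def in_keys_iff)
  finally have "P M \<noteq> 0" by auto
  with ind P have "\<exists>x\<in>S. eval_mpol x (P M) \<noteq> 0" unfolding indep_on_def by blast
  with that[of M "\<lambda>j x. eval_mpol x (P j)"] polyfun_eval[OF F P] rel show ?thesis by simp
qed

text \<open>Pseudo-division by the equation of \<open>x e\<close> turns (a_M x_e)^k into a
  combination of the powers of \<open>x e\<close> below \<open>M\<close>, with coefficients of
  degree kD. Up to the denominator a_M^d, a function of degree \<open>d\<close> is thus given by
  \<open>M\<close> functions of degree d(1+D) in the variables of \<open>F\<close>: the constants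
  grow, the exponent \<open>r\<close> stays.\<close>

lemma growth_insert:
  fixes S :: "(nat \<Rightarrow> 'k::field) set"
  assumes Z: "finite Z" "F \<subseteq> Z" and irr: "irreducible_on Z S" and gr: "growth Z S F r"
    and a: "\<And>j. j \<le> M \<Longrightarrow> a j \<in> polyfun F" and aM: "\<exists>x\<in>S. a M x \<noteq> 0"
    and rel: "\<And>x. x \<in> S \<Longrightarrow> (\<Sum>j\<le>M. a j x * x e ^ j) = 0"
  shows "growth Z S (insert e F) r"
proof -
  have F: "finite F" using Z finite_subset by blast
  obtain D where D: "\<And>j. j \<le> M \<Longrightarrow> a j \<in> bpoly F D"
    using polyfun_common_degree[OF F, of "{..M}" a] a by auto
  obtain S' C c where S': "S' \<subseteq> S" "dense_in Z S' S"
    and sp: "\<And>d. spanned (bpoly F d) S' (C * (c * d + 1) ^ r)"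
    using gr unfolding growth_def by blast
  \<comment> \<open>For \<open>M = 0\<close> the relation would say that \<open>a M\<close> vanishes
    on \<open>S\<close>.\<close>
  have "M \<noteq> 0"
  proof
    assume "M = 0"
    with aM rel show False by auto
  qed
  then obtain M0 where M0: "M = Suc M0" by (cases M) auto
  have relM: "a M x * x e ^ M = - (\<Sum>l<M. a l x * x e ^ l)" if "x \<in> S" for x
    using rel[OF that] by (simp add: lessThan_Suc_atMost[symmetric] eq_neg_iff_add_eq_0 add.commute)
  \<comment> \<open>Here division by \<open>a M\<close> is possible. These points are still dense,
    since irreducibility allows the factor \<open>a M\<close> to be cancelled.\<close>
  define S'' where "S'' = {x \<in> S'. a M x \<noteq> 0}"
  have dense: "dense_in Z S'' S"
    unfolding dense_in_def
  proof (intro ballI impI)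
    fix f x assume f: "f \<in> polyfun Z" "\<forall>x\<in>S''. f x = 0" and x: "x \<in> S"
    have aMZ: "a M \<in> polyfun Z" using polyfun_mono[OF Z] a by blast
    have "(\<lambda>x. f x * a M x) \<in> polyfun Z" by (rule polyfun_mult[OF Z(1) f(1) aMZ])
    from dense_inD[OF S'(2) this] have "\<forall>x\<in>S. f x * a M x = 0"
      using f(2) by (auto simp: S''_def)
    with irr f(1) aMZ aM x show "f x = 0" unfolding irreducible_on_def by blast
  qed
  have red: "\<exists>b. (\<forall>l<M. b l \<in> bpoly F (k * D)) \<and>
      (\<forall>x\<in>S. a M x ^ k * x e ^ k = (\<Sum>l<M. b l x * x e ^ l))" for k
  proof (induction k)
    case 0
    have "(\<Sum>l<M. (if l = 0 then 1 else 0) * x e ^ l) = 1" for x :: "nat \<Rightarrow> 'k"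
      unfolding M0 by (subst sum.lessThan_Suc_shift) simp
    then show ?case
      by (intro exI[of _ "\<lambda>l x. if l = 0 then 1 else 0"]) (simp add: bpoly_const[OF F])
  next
    case (Suc k)
    then obtain b where b: "\<And>l. l < M \<Longrightarrow> b l \<in> bpoly F (k * D)"
      "\<And>x. x \<in> S \<Longrightarrow> a M x ^ k * x e ^ k = (\<Sum>l<M. b l x * x e ^ l)" by blast
    \<comment> \<open>Multiplication by \<open>x e\<close> shifts the coefficients by one place; the
      term with exponent \<open>M\<close> that appears at the top is replaced through
      \<open>relM\<close>.\<close>
    define b' where "b' l x = a M x * (if l = 0 then 0 else b (l - 1) x) + b M0 x * (- 1 * a l x)" for l x
    have "b' l \<in> bpoly F (Suc k * D)" if l: "l < M" for l
    proof -
      have "(\<lambda>x. if l = 0 then 0 else b (l - 1) x) \<in> bpoly F (k * D)"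
        using l b(1)[of "l - 1"] by (cases "l = 0") (auto simp: bpoly_0)
      from bpoly_mult[OF F D[of M] this]
      have 1: "(\<lambda>x. a M x * (if l = 0 then 0 else b (l - 1) x)) \<in> bpoly F (Suc k * D)" by simp
      have "(\<lambda>x. - 1 * a l x) \<in> bpoly F D" using l by (intro bpoly_scale D) auto
      from bpoly_mult[OF F b(1)[of M0] this]
      have 2: "(\<lambda>x. b M0 x * (- 1 * a l x)) \<in> bpoly F (Suc k * D)" by (simp add: M0 add.commute)
      show ?thesis unfolding b'_def by (rule bpoly_add[OF 1 2])
    qed
    moreover have "a M x ^ Suc k * x e ^ Suc k = (\<Sum>l<M. b' l x * x e ^ l)" if x: "x \<in> S" for x
    proof -
      have "a M x ^ Suc k * x e ^ Suc k = a M x * x e * (\<Sum>l<M. b l x * x e ^ l)"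
        by (simp add: b(2)[OF x, symmetric] mult_ac)
      also have "\<dots> = (\<Sum>l<M0. a M x * b l x * x e ^ Suc l) + b M0 x * (a M x * x e ^ M)"
        unfolding M0 by (simp add: sum_distrib_left distrib_left mult_ac)
      also have "(\<Sum>l<M0. a M x * b l x * x e ^ Suc l) =
          (\<Sum>l<M. a M x * (if l = 0 then 0 else b (l - 1) x) * x e ^ l)"
        unfolding M0 by (subst sum.lessThan_Suc_shift) simp
      also have "b M0 x * (a M x * x e ^ M) = (\<Sum>l<M. b M0 x * (- 1 * a l x) * x e ^ l)"
        unfolding relM[OF x] by (simp add: sum_distrib_left sum_negf mult.assoc)
      finally show ?thesis by (simp only: b'_def sum.distrib distrib_right)
    qed
    ultimately show ?case by blast
  qed
  have "spanned (bpoly (insert e F) d) S'' ((C * M) * ((c * (1 + D)) * d + 1) ^ r)" for d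
  proof -
    define n where "n = C * (c * (d * (1 + D)) + 1) ^ r"
    obtain h where h: "\<And>f. f \<in> bpoly F (d * (1 + D)) \<Longrightarrow> \<exists>\<gamma>. \<forall>x\<in>S'. f x = (\<Sum>t<n. \<gamma> t * h t x)"
      using sp[of "d * (1 + D)"] unfolding spanned_def n_def by blast
    show ?thesis
    proof (rule spanned_bpolyI[where T = "{..<M} \<times> {..<n}" and h = "\<lambda>(l, t) x. h t x * x e ^ l / a M x ^ d"])
      show "card ({..<M} \<times> {..<n}) \<le> C * M * (c * (1 + D) * d + 1) ^ r"
      proof -
        have "c * (d * (1 + D)) = c * (1 + D) * d" by (simp only: mult_ac)
        then show ?thesis by (simp only: n_def card_cartesian_product card_lessThan mult_ac)
      qed
      fix m assume m: "m \<in> box (insert e F) d"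
      define k where "k = Poly_Mapping.lookup m e"
      have k: "k \<le> d" using m by (auto simp: box_def k_def)
      obtain b where b: "\<And>l. l < M \<Longrightarrow> b l \<in> bpoly F (k * D)"
        "\<And>x. x \<in> S \<Longrightarrow> a M x ^ k * x e ^ k = (\<Sum>l<M. b l x * x e ^ l)"
        using red[of k] by blast
      have "\<exists>\<gamma>. \<forall>x\<in>S'. a M x ^ (d - k) * (mon (drop_var e m) x * b l x) = (\<Sum>t<n. \<gamma> t * h t x)"
        if l: "l < M" for l
      proof (rule h)
        \<comment> \<open>The power \<open>d - k\<close> gives all monomials the same denominator,
          and the degrees (d-k)D, d and kD add up to d(1+D) whatever \<open>k\<close> is.\<close>
        have "(\<lambda>x. a M x ^ (d - k) * (mon (drop_var e m) x * b l x)) \<in> bpoly F ((d - k) * D + (d + k * D))"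
          by (intro bpoly_mult bpoly_power bpoly_mon drop_var_box m F D b(1) l order_refl)
        moreover have "(d - k) * D + (d + k * D) = d * (1 + D)"
          using k by (simp add: algebra_simps flip: add_mult_distrib)
        ultimately show "(\<lambda>x. a M x ^ (d - k) * (mon (drop_var e m) x * b l x)) \<in> bpoly F (d * (1 + D))"
          by metis
      qed
      then have "\<forall>l\<in>{..<M}. \<exists>\<gamma>. \<forall>x\<in>S'. a M x ^ (d - k) * (mon (drop_var e m) x * b l x) = (\<Sum>t<n. \<gamma> t * h t x)"
        by blast
      from bchoice[OF this] obtain \<gamma> where \<gamma>: "\<And>l x. l < M \<Longrightarrow> x \<in> S' \<Longrightarrow>
          a M x ^ (d - k) * (mon (drop_var e m) x * b l x) = (\<Sum>t<n. \<gamma> l t * h t x)" by auto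
      have "mon m x = (\<Sum>(l, t)\<in>{..<M} \<times> {..<n}. \<gamma> l t * (h t x * x e ^ l / a M x ^ d))" if x: "x \<in> S''" for x
      proof -
        have x': "x \<in> S'" "x \<in> S" "a M x \<noteq> 0" using x S'(1) by (auto simp: S''_def)
        have "a M x ^ d * mon m x = a M x ^ (d - k) * mon (drop_var e m) x * (a M x ^ k * x e ^ k)"
          using k by (simp add: mon_drop_var[of m x e] k_def flip: power_add)
        also have "\<dots> = (\<Sum>l<M. a M x ^ (d - k) * (mon (drop_var e m) x * b l x) * x e ^ l)"
          unfolding b(2)[OF x'(2)] by (simp add: sum_distrib_left mult_ac)
        also have "\<dots> = (\<Sum>l<M. \<Sum>t<n. \<gamma> l t * (h t x * x e ^ l))"
          by (intro sum.cong refl, subst \<gamma>) (auto simp: x'(1) sum_distrib_left mult_ac)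
        finally have "mon m x = (\<Sum>l<M. \<Sum>t<n. \<gamma> l t * (h t x * x e ^ l)) / a M x ^ d"
          using x'(3) by (simp add: field_simps)
        then show ?thesis
          by (simp add: sum.cartesian_product[symmetric] sum_divide_distrib)
      qed
      then show "\<exists>\<gamma>. \<forall>x\<in>S''. mon m x =
          (\<Sum>t\<in>{..<M} \<times> {..<n}. \<gamma> t * (case t of (l, t) \<Rightarrow> \<lambda>x. h t x * x e ^ l / a M x ^ d) x)"
        by (intro exI[of _ "\<lambda>(l, t). \<gamma> l t"]) (auto simp: case_prod_unfold)
    qed simp
  qed
  moreover have "S'' \<subseteq> S" using S'(1) by (auto simp: S''_def)
  ultimately show ?thesis unfolding growth_def using dense by blast
qed

text \<open>The elements of \<open>F - I\<close> are adjoined one at a time. Each satisfies an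
  equation over \<open>I\<close> alone, whose coefficients are available at every stage.\<close>

lemma growth_basis:
  fixes S :: "(nat \<Rightarrow> 'k::field) set"
  assumes Z: "finite Z" "F \<subseteq> Z" and irr: "irreducible_on Z S"
    and I: "I \<subseteq> F" "indep_on S I" "\<And>e. e \<in> F - I \<Longrightarrow> \<not> indep_on S (insert e I)"
  shows "growth Z S F (card I)"
proof -
  have fin: "finite I" "finite (F - I)" using Z I(1) by (auto intro: finite_subset)
  have "growth Z S (I \<union> F') (card I)" if "F' \<subseteq> F - I" for F'
    using finite_subset[OF that fin(2)] that
  proof (induction F' rule: finite_induct)
    case empty
    then show ?case using growth_base[OF fin(1)] by simp
  next
    case (insert e F')
    obtain M a where a: "\<And>j. j \<le> M \<Longrightarrow> a j \<in> polyfun I" "\<exists>x\<in>S. a M x \<noteq> 0"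
      "\<And>x. x \<in> S \<Longrightarrow> (\<Sum>j\<le>M. a j x * x e ^ j) = 0"
      using alg_relation[OF fin(1) I(2) I(3)] insert.prems by blast
    have "a j \<in> polyfun (I \<union> F')" if "j \<le> M" for j
      using a(1)[OF that] polyfun_mono[of "I \<union> F'" I] fin(1) insert.hyps(1) by blast
    from growth_insert[OF Z(1) _ irr insert.IH this a(2,3)] insert.prems I(1) Z(2)
    show ?case by auto
  qed
  from this[of "F - I"] I(1) show ?thesis by (simp add: Un_absorb1)
qed

lemma growth_indep_card_le:
  assumes Z: "finite Z" "F \<subseteq> Z" and gr: "growth Z S F r" and J: "J \<subseteq> F" "indep_on S J"
  shows "card J \<le> r"
proof (rule growth_bound[OF Z gr, where f = "\<lambda>i x. x i"])
  show "finite J" using Z J(1) by (meson finite_subset)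
  fix i assume "i \<in> J"
  then show "(\<lambda>x. x i) \<in> polyfun F"
    using J(1) Z finite_subset by (intro bpoly_polyfun[of _ _ 1] bpoly_var) auto
next
  fix q assume q: "q \<in> poly_ring J" "\<And>x. x \<in> S \<Longrightarrow> eval_mpol (\<lambda>i. if i \<in> J then x i else 0) q = 0"
  have "eval_mpol x q = 0" if "x \<in> S" for x
    using q(2)[OF that] eval_mpol_cong[OF q(1), of x "\<lambda>i. if i \<in> J then x i else 0"] by simp
  with J(2) q(1) show "q = 0" unfolding indep_on_def by blast
qed

section \<open>Minkowski sums\<close>

lemma dense_in_plus_set:
  assumes Z: "finite Z" and S: "dense_in Z S' S" and T: "dense_in Z T' T"
  shows "dense_in Z (plus_set S' T') (plus_set S T)"
  unfolding dense_in_def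
proof (intro ballI impI)
  fix f z assume f: "f \<in> polyfun Z" "\<forall>z\<in>plus_set S' T'. f z = 0" and z: "z \<in> plus_set S T"
  obtain x y where xy: "x \<in> S" "y \<in> T" "z = (\<lambda>i. x i + y i)" using z by (auto simp: plus_set_def)
  \<comment> \<open>Density is used in one summand at a time: for a fixed second summand,
    \<open>f\<close> of the sum is a polynomial function of the first.\<close>
  have 1: "f (\<lambda>i. x i + y i) = 0" if "y \<in> T'" for y
    by (rule dense_inD[OF S polyfun_shift(1)[OF Z f(1)] _ xy(1)])
       (use f(2) that in \<open>auto simp: plus_set_def\<close>)
  show "f z = 0" unfolding xy(3)
    by (rule dense_inD[OF T polyfun_shift(2)[OF Z f(1)] _ xy(2)]) (rule 1)
qed

text \<open>If neither factor vanished on the sums, irreducibility of \<open>S\<close> would give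
  one \<open>x\<close> such that neither f(x + y) nor g(x + y) vanishes for all \<open>y\<close> in
  \<open>T\<close>, against irreducibility of \<open>T\<close>.\<close>

lemma irreducible_on_plus_set:
  assumes Z: "finite Z" and S: "irreducible_on Z S" and T: "irreducible_on Z T"
  shows "irreducible_on Z (plus_set S T)"
  unfolding irreducible_on_def
proof (intro conjI ballI impI)
  show "plus_set S T \<noteq> {}" using S T by (auto simp: irreducible_on_def plus_set_def)
  fix f g assume f: "f \<in> polyfun Z" and g: "g \<in> polyfun Z"
    and fg: "\<forall>z\<in>plus_set S T. f z * g z = 0"
  show "(\<forall>z\<in>plus_set S T. f z = 0) \<or> (\<forall>z\<in>plus_set S T. g z = 0)"
  proof (rule ccontr)
    assume "\<not> ?thesis"
    then obtain x1 y1 x2 y2 where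
      1: "x1 \<in> S" "y1 \<in> T" "f (\<lambda>i. x1 i + y1 i) \<noteq> 0" and 2: "x2 \<in> S" "y2 \<in> T" "g (\<lambda>i. x2 i + y2 i) \<noteq> 0"
      unfolding plus_set_def by blast
    have "\<not> (\<forall>x\<in>S. f (\<lambda>i. x i + y1 i) * g (\<lambda>i. x i + y2 i) = 0)"
    proof
      assume "\<forall>x\<in>S. f (\<lambda>i. x i + y1 i) * g (\<lambda>i. x i + y2 i) = 0"
      with S polyfun_shift(1)[OF Z f, of y1] polyfun_shift(1)[OF Z g, of y2]
      have "(\<forall>x\<in>S. f (\<lambda>i. x i + y1 i) = 0) \<or> (\<forall>x\<in>S. g (\<lambda>i. x i + y2 i) = 0)"
        unfolding irreducible_on_def by simp
      with 1 2 show False by blast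
    qed
    then obtain x where x: "x \<in> S" "f (\<lambda>i. x i + y1 i) \<noteq> 0" "g (\<lambda>i. x i + y2 i) \<noteq> 0" by auto
    have "\<forall>y\<in>T. f (\<lambda>i. x i + y i) * g (\<lambda>i. x i + y i) = 0"
      using fg x(1) unfolding plus_set_def by blast
    with T polyfun_shift(2)[OF Z f, of x] polyfun_shift(2)[OF Z g, of x]
    have "(\<forall>y\<in>T. f (\<lambda>i. x i + y i) = 0) \<or> (\<forall>y\<in>T. g (\<lambda>i. x i + y i) = 0)"
      unfolding irreducible_on_def by simp
    with x 1 2 show False by blast
  qed
qed

text \<open>Products of the two spanning families suffice, so dimensions multiply and growth
  exponents will add.\<close>

lemma tens_factor:
  assumes "H \<in> tens F d"
    and h: "\<And>f. f \<in> bpoly F d \<Longrightarrow> \<exists>\<gamma>. \<forall>x\<in>S. f x = (\<Sum>t<n. \<gamma> t * h t x)"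
    and h': "\<And>f. f \<in> bpoly F d \<Longrightarrow> \<exists>\<gamma>. \<forall>x\<in>T. f x = (\<Sum>t<n'. \<gamma> t * h' t x)"
  shows "\<exists>\<gamma>. \<forall>x\<in>S. \<forall>y\<in>T. H x y = (\<Sum>(t, t')\<in>{..<n} \<times> {..<n'}. \<gamma> t t' * (h t x * h' t' y))"
  using assms(1)
proof induction
  case (prod u v)
  obtain \<gamma> \<delta> where "\<And>x. x \<in> S \<Longrightarrow> u x = (\<Sum>t<n. \<gamma> t * h t x)" "\<And>y. y \<in> T \<Longrightarrow> v y = (\<Sum>t<n'. \<delta> t * h' t y)"
    using h[OF prod(1)] h'[OF prod(2)] by blast
  then have "\<forall>x\<in>S. \<forall>y\<in>T. u x * v y =
      (\<Sum>(t, t')\<in>{..<n} \<times> {..<n'}. (\<gamma> t * \<delta> t') * (h t x * h' t' y))"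
    by (simp add: sum_product sum.cartesian_product[symmetric] mult_ac)
  then show ?case by (rule exI[of _ "\<lambda>t t'. \<gamma> t * \<delta> t'"])
next
  case (add H H')
  then obtain \<gamma> \<delta> where
    "\<And>x y. x \<in> S \<Longrightarrow> y \<in> T \<Longrightarrow> H x y = (\<Sum>(t, t')\<in>{..<n} \<times> {..<n'}. \<gamma> t t' * (h t x * h' t' y))"
    "\<And>x y. x \<in> S \<Longrightarrow> y \<in> T \<Longrightarrow> H' x y = (\<Sum>(t, t')\<in>{..<n} \<times> {..<n'}. \<delta> t t' * (h t x * h' t' y))"
    by blast
  then show ?case
    by (intro exI[of _ "\<lambda>t t'. \<gamma> t t' + \<delta> t t'"])
       (simp add: sum.cartesian_product[symmetric] sum.distrib distrib_right)
qed

lemma growth_plus_set: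
  fixes S T :: "(nat \<Rightarrow> 'k::field) set"
  assumes Z: "finite Z" "F \<subseteq> Z" and S: "growth Z S F r" and T: "growth Z T F r'"
  shows "growth Z (plus_set S T) F (r + r')"
proof -
  have F: "finite F" using Z finite_subset by blast
  obtain S' C c where S': "S' \<subseteq> S" "dense_in Z S' S"
    and spS: "\<And>d. spanned (bpoly F d) S' (C * (c * d + 1) ^ r)"
    using S unfolding growth_def by blast
  obtain T' C' c' where T': "T' \<subseteq> T" "dense_in Z T' T"
    and spT: "\<And>d. spanned (bpoly F d) T' (C' * (c' * d + 1) ^ r')"
    using T unfolding growth_def by blast
  \<comment> \<open>\<open>card F\<close> is the degree factor of \<open>bpoly_shift_tens\<close>;
    the maximum gives both bounds a common base.\<close>
  define c0 where "c0 = max c c' * card F"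
  have "spanned (bpoly F d) (plus_set S' T') ((C * C') * (c0 * d + 1) ^ (r + r'))" for d
  proof -
    define n where "n = C * (c * (card F * d) + 1) ^ r"
    define n' where "n' = C' * (c' * (card F * d) + 1) ^ r'"
    obtain h where h: "\<And>f. f \<in> bpoly F (card F * d) \<Longrightarrow> \<exists>\<gamma>. \<forall>x\<in>S'. f x = (\<Sum>t<n. \<gamma> t * h t x)"
      using spS[of "card F * d"] unfolding spanned_def n_def by blast
    obtain h' where h': "\<And>f. f \<in> bpoly F (card F * d) \<Longrightarrow> \<exists>\<gamma>. \<forall>x\<in>T'. f x = (\<Sum>t<n'. \<gamma> t * h' t x)"
      using spT[of "card F * d"] unfolding spanned_def n'_def by blast
    \<comment> \<open>One decomposition is fixed for every point. The spanning functions depend on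
      it, the value of \<open>f\<close> does not.\<close>
    have "\<forall>z\<in>plus_set S' T'. \<exists>xy. fst xy \<in> S' \<and> snd xy \<in> T' \<and> z = (\<lambda>i. fst xy i + snd xy i)"
      by (auto simp: plus_set_def)
    from bchoice[OF this] obtain \<pi> where \<pi>: "\<And>z. z \<in> plus_set S' T' \<Longrightarrow>
        fst (\<pi> z) \<in> S' \<and> snd (\<pi> z) \<in> T' \<and> z = (\<lambda>i. fst (\<pi> z) i + snd (\<pi> z) i)" by blast
    show ?thesis
    proof (rule spannedI[where T = "{..<n} \<times> {..<n'}" and h = "\<lambda>tt z. h (fst tt) (fst (\<pi> z)) * h' (snd tt) (snd (\<pi> z))"])
      have "n \<le> C * (c0 * d + 1) ^ r" "n' \<le> C' * (c0 * d + 1) ^ r'"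
        unfolding n_def n'_def c0_def
        by (auto intro!: mult_le_mono power_mono simp: mult.assoc[symmetric])
      then have "n * n' \<le> (C * (c0 * d + 1) ^ r) * (C' * (c0 * d + 1) ^ r')" by (rule mult_le_mono)
      then show "card ({..<n} \<times> {..<n'}) \<le> C * C' * (c0 * d + 1) ^ (r + r')"
        by (simp add: power_add mult_ac)
      fix f :: "(nat \<Rightarrow> 'k) \<Rightarrow> 'k" assume "f \<in> bpoly F d"
      from tens_factor[OF bpoly_shift_tens[OF F this] h h'] obtain \<gamma> where
        \<gamma>: "\<And>x y. x \<in> S' \<Longrightarrow> y \<in> T' \<Longrightarrow>
          f (\<lambda>i. x i + y i) = (\<Sum>(t, t')\<in>{..<n} \<times> {..<n'}. \<gamma> t t' * (h t x * h' t' y))" by blast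
      have "f z = (\<Sum>tt\<in>{..<n} \<times> {..<n'}. \<gamma> (fst tt) (snd tt) * (h (fst tt) (fst (\<pi> z)) * h' (snd tt) (snd (\<pi> z))))"
        if "z \<in> plus_set S' T'" for z
        using \<gamma>[of "fst (\<pi> z)" "snd (\<pi> z)"] \<pi>[OF that] by (simp add: case_prod_unfold)
      then show "\<exists>\<gamma>. \<forall>z\<in>plus_set S' T'. f z =
          (\<Sum>tt\<in>{..<n} \<times> {..<n'}. \<gamma> tt * (h (fst tt) (fst (\<pi> z)) * h' (snd tt) (snd (\<pi> z))))"
        by (intro exI[of _ "\<lambda>tt. \<gamma> (fst tt) (snd tt)"] ballI)
    qed simp
  qed
  moreover have "plus_set S' T' \<subseteq> plus_set S T" using S'(1) T'(1) unfolding plus_set_def by blast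
  ultimately show ?thesis
    unfolding growth_def using dense_in_plus_set[OF Z(1) S'(2) T'(2)] by blast
qed

section \<open>Ranks and matroid union\<close>

text \<open>\<open>card_le_maximal\<close> stands in for the exchange axiom, being the form that a
  comparison of growth exponents delivers.\<close>

locale finite_matroid =
  fixes E :: "'a set" and Ind :: "'a set \<Rightarrow> bool"
  assumes finite_E: "finite E"
    and Ind_empty: "Ind {}"
    and Ind_subset: "Ind J \<Longrightarrow> I \<subseteq> J \<Longrightarrow> Ind I"
    and card_le_maximal: "F \<subseteq> E \<Longrightarrow> I \<subseteq> F \<Longrightarrow> J \<subseteq> F \<Longrightarrow> Ind I \<Longrightarrow> Ind J \<Longrightarrow>
      (\<And>e. e \<in> F - I \<Longrightarrow> \<not> Ind (insert e I)) \<Longrightarrow> card J \<le> card I"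
begin

definition rk :: "'a set \<Rightarrow> nat" where
  "rk F = Max (card ` {I. I \<subseteq> F \<and> Ind I})"

lemma card_le_rk:
  assumes "F \<subseteq> E" "I \<subseteq> F" "Ind I"
  shows "card I \<le> rk F"
  unfolding rk_def using assms finite_subset[OF assms(1) finite_E]
  by (intro Max_ge) (auto intro: finite_subset[of _ "Pow F"])

lemma maximal_extension:
  assumes "F \<subseteq> E" "I \<subseteq> F" "Ind I"
  shows "\<exists>J. I \<subseteq> J \<and> J \<subseteq> F \<and> Ind J \<and> (\<forall>e\<in>F - J. \<not> Ind (insert e J))"
proof -
  have fin: "finite F" using assms(1) finite_E by (rule finite_subset)
  define K where "K = {J. J \<subseteq> F \<and> Ind J}"
  have "finite K" using fin by (auto simp: K_def intro: finite_subset[of _ "Pow F"])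
  moreover have "I \<in> K" using assms by (simp add: K_def)
  ultimately have "\<exists>J\<in>K. I \<subseteq> J \<and> (\<forall>J'\<in>K. J \<subseteq> J' \<longrightarrow> J = J')"
    by (rule finite_has_maximal2)
  then obtain J where J: "I \<subseteq> J" "J \<in> K" "\<forall>J'\<in>K. J \<subseteq> J' \<longrightarrow> J = J'" by (elim bexE conjE)
  have "\<not> Ind (insert e J)" if e: "e \<in> F - J" for e
  proof
    assume "Ind (insert e J)"
    with J(2) e have "insert e J \<in> K" by (simp add: K_def)
    with J(3) have "J = insert e J" by blast
    with e show False by blast
  qed
  with J(1,2) show ?thesis by (intro exI[of _ J]) (auto simp: K_def)
qed

lemma card_maximal:
  assumes "F \<subseteq> E" "I \<subseteq> F" "Ind I" "\<forall>e\<in>F - I. \<not> Ind (insert e I)"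
  shows "card I = rk F"
proof (rule antisym)
  show "card I \<le> rk F" using assms by (intro card_le_rk)
  show "rk F \<le> card I" unfolding rk_def
    using assms Ind_empty finite_subset[OF assms(1) finite_E]
    by (subst Max_le_iff) (auto intro: finite_subset[of _ "Pow F"] card_le_maximal)
qed

lemma basis:
  assumes "F \<subseteq> E"
  shows "\<exists>I. I \<subseteq> F \<and> Ind I \<and> card I = rk F"
proof -
  obtain I where "I \<subseteq> F" "Ind I" "\<forall>e\<in>F - I. \<not> Ind (insert e I)"
    using maximal_extension[OF assms empty_subsetI Ind_empty] by auto
  with card_maximal[OF assms] show ?thesis by blast
qed

lemma rk_mono:
  assumes "F \<subseteq> G" "G \<subseteq> E"
  shows "rk F \<le> rk G"
proof -
  obtain I where "I \<subseteq> F" "Ind I" "card I = rk F" using basis[of F] assms by blast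
  with card_le_rk[OF assms(2), of I] assms(1) show ?thesis by auto
qed

lemma rk_le_card:
  assumes "F \<subseteq> E"
  shows "rk F \<le> card F"
proof -
  obtain I where "I \<subseteq> F" "card I = rk F" using basis[OF assms] by blast
  with card_mono[of F I] finite_subset[OF assms finite_E] show ?thesis by simp
qed

lemma Ind_if_rk_eq_card:
  assumes "F \<subseteq> E" "rk F = card F"
  shows "Ind F"
proof -
  obtain I where "I \<subseteq> F" "Ind I" "card I = rk F" using basis[OF assms(1)] by blast
  with card_subset_eq[of F I] finite_subset[OF assms(1) finite_E] assms(2) show ?thesis by simp
qed

text \<open>A largest independent subset \<open>I\<close> of the intersection is extended to a
  maximal \<open>J\<close> in the union. Counting \<open>J\<close> on \<open>A\<close> and on
  \<open>B\<close> counts it once in full and once more on the intersection, where it contains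
  \<open>I\<close>.\<close>

lemma rk_submodular:
  assumes A: "A \<subseteq> E" and B: "B \<subseteq> E"
  shows "rk (A \<union> B) + rk (A \<inter> B) \<le> rk A + rk B"
proof -
  obtain I where I: "I \<subseteq> A \<inter> B" "Ind I" "card I = rk (A \<inter> B)"
    using basis[of "A \<inter> B"] A by blast
  obtain J where J: "I \<subseteq> J" "J \<subseteq> A \<union> B" "Ind J" "\<forall>e\<in>(A \<union> B) - J. \<not> Ind (insert e J)"
    using maximal_extension[of "A \<union> B" I] A B I by blast
  have fin: "finite J" using J(2) A B finite_E by (meson finite_subset Un_least)
  have "card J = rk (A \<union> B)" using J A B by (intro card_maximal) auto
  moreover have "card (J \<inter> A) \<le> rk A" "card (J \<inter> B) \<le> rk B"
    using A B Ind_subset[OF J(3)] by (auto intro!: card_le_rk)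
  moreover have "card (J \<inter> A) + card (J \<inter> B) = card J + card (J \<inter> (A \<inter> B))"
  proof -
    have "(J \<inter> A) \<union> (J \<inter> B) = J" "(J \<inter> A) \<inter> (J \<inter> B) = J \<inter> (A \<inter> B)" using J(2) by auto
    with card_Un_Int[of "J \<inter> A" "J \<inter> B"] fin show ?thesis by simp
  qed
  moreover have "card I \<le> card (J \<inter> (A \<inter> B))"
    using I(1) J(1) fin by (intro card_mono) auto
  ultimately show ?thesis using I(3) by simp
qed

end

text \<open>
  Rado's argument: the relation \<open>R\<close> records which matroids may still be used for an element; by
  submodularity of the rank, of two choices for the same element one can always be discarded.
\<close>

lemma matroid_union_cover_aux:
  fixes M :: "'i \<Rightarrow> 'a set \<Rightarrow> bool"
  assumes A: "finite A" and mat: "\<And>i. i \<in> A \<Longrightarrow> finite_matroid E (M i)" and finE: "finite E"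
    and R: "finite R" "R \<subseteq> A \<times> E"
    and rado: "\<And>F. F \<subseteq> E \<Longrightarrow> card F \<le> (\<Sum>i\<in>A. finite_matroid.rk (M i) {e \<in> F. (i, e) \<in> R})"
  shows "\<exists>J. (\<forall>i\<in>A. M i (J i)) \<and> (\<Union>i\<in>A. J i) = E"
  using R rado
proof (induction R rule: finite_psubset_induct)
  case (psubset R)
  let ?rk = "\<lambda>i. finite_matroid.rk (M i)"
  let ?at = "\<lambda>R F i. {e \<in> F. (i, e) \<in> R}"
  show ?case
  proof (cases "\<exists>a b e. (a, e) \<in> R \<and> (b, e) \<in> R \<and> a \<noteq> b")
    case True
    then obtain a b e where abe: "(a, e) \<in> R" "(b, e) \<in> R" "a \<noteq> b" by blast
    \<comment> \<open>If both deletions broke the condition, there would be violating sets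
      \<open>F1\<close> and \<open>F2\<close>; the old condition on their union and on their
      intersection without \<open>e\<close> refutes this.\<close>
    have "\<exists>c\<in>{a, b}. \<forall>F\<subseteq>E. card F \<le> (\<Sum>i\<in>A. ?rk i (?at (R - {(c, e)}) F i))"
    proof (rule ccontr)
      assume "\<not> ?thesis"
      then obtain F1 F2 where
        F1: "F1 \<subseteq> E" "(\<Sum>i\<in>A. ?rk i (?at (R - {(a, e)}) F1 i)) < card F1" and
        F2: "F2 \<subseteq> E" "(\<Sum>i\<in>A. ?rk i (?at (R - {(b, e)}) F2 i)) < card F2"
        by (auto simp: not_le)
      have "e \<in> F1"
      proof (rule ccontr)
        assume "e \<notin> F1"
        then have "?at (R - {(a, e)}) F1 i = ?at R F1 i" for i by auto
        with F1 psubset.prems(2)[OF F1(1)] show False by simp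
      qed
      have "e \<in> F2"
      proof (rule ccontr)
        assume "e \<notin> F2"
        then have "?at (R - {(b, e)}) F2 i = ?at R F2 i" for i by auto
        with F2 psubset.prems(2)[OF F2(1)] show False by simp
      qed
      have sub: "?rk i (?at R (F1 \<union> F2) i) + ?rk i (?at R (F1 \<inter> F2 - {e}) i)
          \<le> ?rk i (?at (R - {(a, e)}) F1 i) + ?rk i (?at (R - {(b, e)}) F2 i)" if i: "i \<in> A" for i
      proof -
        interpret finite_matroid E "M i" using mat[OF i] .
        let ?P = "?at (R - {(a, e)}) F1 i" and ?Q = "?at (R - {(b, e)}) F2 i"
        have PQ: "?P \<subseteq> E" "?Q \<subseteq> E" using F1(1) F2(1) by auto
        \<comment> \<open>As \<open>a\<close> and \<open>b\<close> differ, no matroid loses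
          \<open>e\<close> on both sides, so the union of \<open>?P\<close> and \<open>?Q\<close>
          misses nothing. Their intersection may lose \<open>e\<close>, which is why
          \<open>e\<close> is removed there.\<close>
        have "rk (?at R (F1 \<union> F2) i) \<le> rk (?P \<union> ?Q)"
          using PQ abe(3) \<open>e \<in> F1\<close> \<open>e \<in> F2\<close> by (intro rk_mono) auto
        moreover have "rk (?at R (F1 \<inter> F2 - {e}) i) \<le> rk (?P \<inter> ?Q)"
          using PQ by (intro rk_mono) auto
        ultimately show ?thesis using rk_submodular[OF PQ] by linarith
      qed
      have fin: "finite F1" "finite F2" using F1(1) F2(1) finE finite_subset by auto
      have "card (F1 \<union> F2) + card (F1 \<inter> F2 - {e})
          \<le> (\<Sum>i\<in>A. ?rk i (?at R (F1 \<union> F2) i)) + (\<Sum>i\<in>A. ?rk i (?at R (F1 \<inter> F2 - {e}) i))"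
        using F1(1) F2(1) by (intro add_mono psubset.prems(2)) auto
      also have "\<dots> \<le> (\<Sum>i\<in>A. ?rk i (?at (R - {(a, e)}) F1 i)) + (\<Sum>i\<in>A. ?rk i (?at (R - {(b, e)}) F2 i))"
        unfolding sum.distrib[symmetric] by (intro sum_mono sub)
      \<comment> \<open>Two strict inequalities gain 2, while removing \<open>e\<close> from the
        intersection costs only 1.\<close>
      also have "\<dots> + 2 \<le> card F1 + card F2" using F1(2) F2(2) by simp
      also have "card F1 + card F2 = card (F1 \<union> F2) + card (F1 \<inter> F2)" by (rule card_Un_Int[OF fin])
      also have "card (F1 \<inter> F2) = Suc (card (F1 \<inter> F2 - {e}))"
        using fin \<open>e \<in> F1\<close> \<open>e \<in> F2\<close> by (subst card_Suc_Diff1) auto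
      finally show False by simp
    qed
    then obtain c where c: "c \<in> {a, b}"
      "\<And>F. F \<subseteq> E \<Longrightarrow> card F \<le> (\<Sum>i\<in>A. ?rk i (?at (R - {(c, e)}) F i))" by blast
    have "R - {(c, e)} \<subset> R" using c(1) abe by auto
    then show ?thesis using psubset.IH[of "R - {(c, e)}"] psubset.prems(1) c(2) by blast
  next
    case False
    \<comment> \<open>Every element now has at most one matroid left, so these sets are disjoint,
      and the condition for \<open>E\<close> itself forces each rank up to the cardinality.\<close>
    let ?J = "\<lambda>i. ?at R E i"
    have J: "?J i \<subseteq> E" for i by auto
    have le: "?rk i (?J i) \<le> card (?J i)" if "i \<in> A" for i
      using finite_matroid.rk_le_card[OF mat[OF that] J] .
    have disj: "card (\<Union>i\<in>A. ?J i) = (\<Sum>i\<in>A. card (?J i))"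
      using False finE A by (intro card_UN_disjoint) auto
    have UJ: "(\<Union>i\<in>A. ?J i) \<subseteq> E" by auto
    have "card E \<le> (\<Sum>i\<in>A. ?rk i (?J i))" using psubset.prems(2)[of E] by simp
    moreover have "(\<Sum>i\<in>A. ?rk i (?J i)) \<le> (\<Sum>i\<in>A. card (?J i))" by (intro sum_mono le)
    moreover have "(\<Sum>i\<in>A. card (?J i)) \<le> card E"
      unfolding disj[symmetric] using UJ finE by (intro card_mono)
    ultimately have eq: "(\<Sum>i\<in>A. ?rk i (?J i)) = (\<Sum>i\<in>A. card (?J i))" "card (\<Union>i\<in>A. ?J i) = card E"
      using disj by simp_all
    have "M i (?J i)" if i: "i \<in> A" for i
      using sum_mono_inv[OF eq(1) le i A] finite_matroid.Ind_if_rk_eq_card[OF mat[OF i] J] by simp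
    moreover have "(\<Union>i\<in>A. ?J i) = E" using eq(2) UJ finE by (intro card_subset_eq)
    ultimately show ?thesis by (intro exI[of _ ?J]) simp
  qed
qed

lemma matroid_union_cover:
  fixes M :: "'i \<Rightarrow> 'a set \<Rightarrow> bool"
  assumes "finite A" and "\<And>i. i \<in> A \<Longrightarrow> finite_matroid E (M i)" and "finite E"
    and "\<And>F. F \<subseteq> E \<Longrightarrow> card F \<le> (\<Sum>i\<in>A. finite_matroid.rk (M i) F)"
  shows "\<exists>J. (\<forall>i\<in>A. M i (J i)) \<and> (\<Union>i\<in>A. J i) = E"
proof (rule matroid_union_cover_aux[where R = "A \<times> E"])
  fix F assume F: "F \<subseteq> E"
  then have "{e \<in> F. (i, e) \<in> A \<times> E} = F" if "i \<in> A" for i using that by auto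
  with assms(4)[OF F] show "card F \<le> (\<Sum>i\<in>A. finite_matroid.rk (M i) {e \<in> F. (i, e) \<in> A \<times> E})"
    by (simp cong: sum.cong)
qed (use assms in auto)

section \<open>Varieties and joins\<close>

lemma zariski_closed_subset: "zariski_closed F Y \<Longrightarrow> Y \<subseteq> affine_space F"
  by (auto simp: zariski_closed_def zero_locus_def)

lemma zariski_closure_superset: "V \<subseteq> zariski_closure F V"
  by (auto simp: zariski_closure_def)

lemma zariski_closure_subset: "zariski_closed F Y \<Longrightarrow> V \<subseteq> Y \<Longrightarrow> zariski_closure F V \<subseteq> Y"
  by (auto simp: zariski_closure_def)

lemma zariski_closed_affine_space: "zariski_closed F (affine_space F)"
  unfolding zariski_closed_def by (intro exI[of _ "{}"]) (auto simp: zero_locus_def)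

lemma dense_in_subset: "S \<subseteq> S' \<Longrightarrow> dense_in F S' S"
  by (auto simp: dense_in_def)

lemma dense_in_trans: "dense_in F S T \<Longrightarrow> dense_in F T U \<Longrightarrow> dense_in F S U"
  by (simp add: dense_in_def)

lemma dense_in_zariski_closure:
  assumes F: "finite F" and V: "V \<subseteq> affine_space F"
  shows "dense_in F V (zariski_closure F V)"
  unfolding dense_in_def
proof (intro ballI impI)
  fix f x assume f: "f \<in> polyfun F" "\<forall>x\<in>V. f x = 0" and x: "x \<in> zariski_closure F V"
  obtain p where p: "p \<in> poly_ring F" "f = (\<lambda>x. eval_mpol x p)" using polyfunE[OF F f(1)] .
  have "zariski_closed F (zero_locus F {p})" using p(1) by (auto simp: zariski_closed_def)
  moreover have "V \<subseteq> zero_locus F {p}" using V f(2) p(2) by (auto simp: zero_locus_def)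
  ultimately have "x \<in> zero_locus F {p}" using zariski_closure_subset x by blast
  then show "f x = 0" using p(2) by (simp add: zero_locus_def)
qed

text \<open>Polynomial functions in the variables of \<open>F\<close> cannot tell a point from its
  projection.\<close>

lemma dense_in_coord_proj:
  fixes X :: "(nat \<Rightarrow> 'k::field) set"
  assumes F: "finite F"
  shows "dense_in F X (coord_proj F ` X)" "dense_in F (coord_proj F ` X) X"
proof -
  have eq: "f (coord_proj F x) = f x" if "f \<in> polyfun F" for f :: "(nat \<Rightarrow> 'k) \<Rightarrow> 'k" and x
    by (rule polyfun_cong[OF F that]) (simp add: coord_proj_def)
  show "dense_in F X (coord_proj F ` X)"
    unfolding dense_in_def using eq by (metis imageE)
  show "dense_in F (coord_proj F ` X) X"
    unfolding dense_in_def using eq by (metis imageI)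
qed

lemma irreducible_variety_imp_irreducible_on:
  assumes F: "finite F" and X: "irreducible_variety F X"
  shows "irreducible_on F X"
  unfolding irreducible_on_def
proof (intro conjI ballI impI)
  show "X \<noteq> {}" using X by (simp add: irreducible_variety_def)
  fix f g assume f: "f \<in> polyfun F" and g: "g \<in> polyfun F" and fg: "\<forall>x\<in>X. f x * g x = 0"
  obtain p where p: "p \<in> poly_ring F" "f = (\<lambda>x. eval_mpol x p)" using polyfunE[OF F f] .
  obtain q where q: "q \<in> poly_ring F" "g = (\<lambda>x. eval_mpol x q)" using polyfunE[OF F g] .
  obtain S where S: "S \<subseteq> poly_ring F" "X = zero_locus F S"
    using X by (auto simp: irreducible_variety_def zariski_closed_def)
  \<comment> \<open>A vanishing product cuts \<open>X\<close> into two closed pieces, one of which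
    must be all of \<open>X\<close>.\<close>
  have "zariski_closed F (zero_locus F (insert p S))" "zariski_closed F (zero_locus F (insert q S))"
    unfolding zariski_closed_def using S(1) p(1) q(1) by blast+
  moreover have "X = zero_locus F (insert p S) \<union> zero_locus F (insert q S)"
    using fg S(2) p(2) q(2) by (auto simp: zero_locus_def)
  ultimately have "X = zero_locus F (insert p S) \<or> X = zero_locus F (insert q S)"
    using X unfolding irreducible_variety_def by blast
  then show "(\<forall>x\<in>X. f x = 0) \<or> (\<forall>x\<in>X. g x = 0)"
    unfolding p(2) q(2) by (auto simp: zero_locus_def)
qed

section \<open>Independence on a set and the algebraic matroid\<close>

lemma poly_ring_mono: "F \<subseteq> F' \<Longrightarrow> poly_ring F \<subseteq> poly_ring F'"
  by (auto simp: poly_ring_def)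

lemma indep_on_subset: "indep_on S J \<Longrightarrow> I \<subseteq> J \<Longrightarrow> indep_on S I"
  using poly_ring_mono[of I J] by (auto simp: indep_on_def)

text \<open>Where density holds in both directions, as between a set and its closure, independence
  is the same on both.\<close>

lemma indep_on_dense:
  assumes "finite F" "I \<subseteq> F" "dense_in F S' S" "indep_on S I"
  shows "indep_on S' I"
  unfolding indep_on_def
proof (intro ballI impI)
  fix p assume p: "p \<in> poly_ring I" "\<forall>x\<in>S'. eval_mpol x p = 0"
  have "(\<lambda>x. eval_mpol x p) \<in> polyfun F"
    using p(1) assms(1,2) poly_ring_mono polyfun_eval by blast
  from dense_inD[OF assms(3) this] p(2) have "\<forall>x\<in>S. eval_mpol x p = 0" by blast
  with assms(4) p(1) show "p = 0" by (simp add: indep_on_def)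
qed

lemma indep_on_empty:
  assumes "S \<noteq> {}"
  shows "indep_on S {}"
  unfolding indep_on_def
proof (intro ballI impI)
  fix p :: "'a mpol" assume p: "p \<in> poly_ring {}" "\<forall>x\<in>S. eval_mpol x p = 0"
  have sub: "Poly_Mapping.keys p \<subseteq> {0}" using p(1) by (auto simp: poly_ring_def)
  obtain x where "x \<in> S" using assms by blast
  with p(2) have "Poly_Mapping.lookup p 0 = 0" using eval_mpol_superset[OF _ sub, of x] by simp
  then have "0 \<notin> Poly_Mapping.keys p" by (simp add: in_keys_iff)
  with sub have "Poly_Mapping.keys p = {}" by blast
  then show "p = 0" by simp
qed

lemma indep_sets_alg_matroid:
  "I \<in> indep_sets (alg_matroid Z X) \<longleftrightarrow> I \<subseteq> Z \<and> indep_on X I"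
proof -
  have "0 \<in> poly_ring F" for F :: "nat set" by (simp add: poly_ring_def)
  moreover have "eval_mpol x 0 = 0" for x :: "nat \<Rightarrow> 'a" by (simp add: eval_mpol_def)
  ultimately have "vanishing_ideal Z X \<inter> poly_ring I = {0} \<longleftrightarrow> indep_on X I" if "I \<subseteq> Z"
    using poly_ring_mono[OF that] unfolding vanishing_ideal_def indep_on_def by blast
  then show ?thesis by (auto simp: alg_matroid_def)
qed

text \<open>A maximal independent \<open>I\<close> in \<open>F\<close> bounds the growth on
  \<open>F\<close> by \<open>card I\<close>, and an independent \<open>J\<close> in \<open>F\<close>
  cannot exceed that bound. \<open>E\<close> may be smaller than \<open>Z\<close>, since the union
  theorem is applied to a single independent set.\<close>

lemma finite_matroid_indep_on:
  assumes Z: "finite Z" "E \<subseteq> Z" and irr: "irreducible_on Z X"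
  shows "finite_matroid E (\<lambda>I. I \<subseteq> E \<and> indep_on X I)"
proof
  show "finite E" using Z finite_subset by blast
  show "{} \<subseteq> E \<and> indep_on X {}" using irr by (simp add: indep_on_empty irreducible_on_def)
  show "I \<subseteq> E \<and> indep_on X I" if "J \<subseteq> E \<and> indep_on X J" "I \<subseteq> J" for I J
    using that indep_on_subset by blast
  fix F I J
  assume *: "F \<subseteq> E" "I \<subseteq> F" "J \<subseteq> F" "I \<subseteq> E \<and> indep_on X I" "J \<subseteq> E \<and> indep_on X J"
    and max: "\<And>e. e \<in> F - I \<Longrightarrow> \<not> (insert e I \<subseteq> E \<and> indep_on X (insert e I))"
  have FZ: "F \<subseteq> Z" using * Z(2) by blast
  have "growth Z X F (card I)"
    by (rule growth_basis[OF Z(1) FZ irr]) (use * max in blast)+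
  with growth_indep_card_le[OF Z(1) FZ] * show "card J \<le> card I" by blast
qed

lemma growth_rk:
  assumes Z: "finite Z" "E \<subseteq> Z" and irr: "irreducible_on Z X" and F: "F \<subseteq> E"
  shows "growth Z X F (finite_matroid.rk (\<lambda>I. I \<subseteq> E \<and> indep_on X I) F)"
proof -
  interpret finite_matroid E "\<lambda>I. I \<subseteq> E \<and> indep_on X I"
    by (rule finite_matroid_indep_on[OF Z irr])
  obtain I where I: "I \<subseteq> F" "I \<subseteq> E \<and> indep_on X I"
    "\<forall>e\<in>F - I. \<not> (insert e I \<subseteq> E \<and> indep_on X (insert e I))"
    using maximal_extension[OF F empty_subsetI Ind_empty] by blast
  have "card I = rk F" using I F by (intro card_maximal) auto
  moreover have "growth Z X F (card I)"
    by (rule growth_basis[OF Z(1) _ irr]) (use I F Z(2) in blast)+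
  ultimately show ?thesis by simp
qed

section \<open>Sums of several sets\<close>

definition sumset :: "nat \<Rightarrow> (nat \<Rightarrow> (nat \<Rightarrow> 'k::field) set) \<Rightarrow> (nat \<Rightarrow> 'k) set" where
  "sumset s Y = {(\<lambda>j. \<Sum>i=1..s. y i j) |y. \<forall>i\<in>{1..s}. y i \<in> Y i}"

text \<open>Growth is computed on \<open>sumset\<close>, where points can be decomposed; density
  links it to the closed join.\<close>

lemma join_eq: "join F s Y = zariski_closure F (sumset s Y)"
  by (simp add: join_def sumset_def)

lemma sumset_0: "sumset 0 Y = {\<lambda>_. 0}"
  by (simp add: sumset_def)

lemma sumset_Suc: "sumset (Suc s) Y = plus_set (sumset s Y) (Y (Suc s))"
proof (intro equalityI subsetI)
  fix z assume "z \<in> sumset (Suc s) Y"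
  then obtain y where y: "\<forall>i\<in>{1..Suc s}. y i \<in> Y i" "z = (\<lambda>j. \<Sum>i=1..Suc s. y i j)"
    by (auto simp: sumset_def)
  have "(\<lambda>j. \<Sum>i=1..s. y i j) \<in> sumset s Y" using y(1) by (auto simp: sumset_def)
  moreover have "y (Suc s) \<in> Y (Suc s)" using y(1) by simp
  moreover have "z = (\<lambda>j. (\<Sum>i=1..s. y i j) + y (Suc s) j)" using y(2) by simp
  ultimately show "z \<in> plus_set (sumset s Y) (Y (Suc s))" unfolding plus_set_def by (intro CollectI exI conjI)
next
  fix z assume "z \<in> plus_set (sumset s Y) (Y (Suc s))"
  then obtain y x where y: "\<forall>i\<in>{1..s}. y i \<in> Y i" "x \<in> Y (Suc s)" "z = (\<lambda>j. (\<Sum>i=1..s. y i j) + x j)"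
    by (auto simp: plus_set_def sumset_def)
  have "(\<Sum>i=1..s. (y(Suc s := x)) i j) = (\<Sum>i=1..s. y i j)" for j
    by (intro sum.cong) auto
  then have "z = (\<lambda>j. \<Sum>i=1..Suc s. (y(Suc s := x)) i j)" using y(3) by (simp add: fun_eq_iff)
  moreover have "\<forall>i\<in>{1..Suc s}. (y(Suc s := x)) i \<in> Y i" using y(1,2) by auto
  ultimately show "z \<in> sumset (Suc s) Y" unfolding sumset_def by blast
qed

lemma sumset_subset_affine_space:
  assumes "\<And>i. i \<in> {1..s} \<Longrightarrow> Y i \<subseteq> affine_space F"
  shows "sumset s Y \<subseteq> affine_space F"
  using assms by (fastforce simp: sumset_def affine_space_def intro: sum.neutral)

lemma irreducible_on_sumset:
  assumes "finite Z" "\<And>i. i \<in> {1..s} \<Longrightarrow> irreducible_on Z (X i)"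
  shows "irreducible_on Z (sumset s X)"
  using assms(2)
  by (induction s)
     (auto simp: sumset_0 sumset_Suc irreducible_on_def[of _ "{_}"] intro!: irreducible_on_plus_set assms(1))

lemma dense_in_sumset:
  assumes "finite Z" "\<And>i. i \<in> {1..s} \<Longrightarrow> dense_in Z (X i) (Y i)"
  shows "dense_in Z (sumset s X) (sumset s Y)"
  using assms(2)
  by (induction s) (auto simp: sumset_0 sumset_Suc dense_in_subset intro!: dense_in_plus_set assms(1))

lemma growth_sumset:
  fixes X :: "nat \<Rightarrow> (nat \<Rightarrow> 'k::field) set"
  assumes "finite Z" "F \<subseteq> Z" "\<And>i. i \<in> {1..s} \<Longrightarrow> growth Z (X i) F (r i)"
  shows "growth Z (sumset s X) F (\<Sum>i=1..s. r i)"
  using assms(3)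
proof (induction s)
  case 0
  \<comment> \<open>The empty sum is the single point 0, on which one constant function spans
    everything.\<close>
  have "spanned (bpoly F d) {\<lambda>_. 0 :: 'k} (1 * (0 * d + 1) ^ 0)" for d
  proof (rule spannedI[where T = "{()}" and h = "\<lambda>_ _. 1"])
    fix f :: "(nat \<Rightarrow> 'k) \<Rightarrow> 'k"
    show "\<exists>\<gamma>. \<forall>x\<in>{\<lambda>_. 0}. f x = (\<Sum>t\<in>{()}. \<gamma> t * 1)"
      by (intro exI[of _ "\<lambda>_. f (\<lambda>_. 0)"]) simp
  qed simp_all
  moreover have "dense_in Z {\<lambda>_. 0 :: 'k} {\<lambda>_. 0}" by (simp add: dense_in_subset)
  ultimately show ?case unfolding growth_def sumset_0 by auto
next
  case (Suc s)
  then have "growth Z (plus_set (sumset s X) (X (Suc s))) F ((\<Sum>i=1..s. r i) + r (Suc s))"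
    by (intro growth_plus_set assms(1,2)) auto
  then show ?case by (simp add: sumset_Suc)
qed

text \<open>Every subset of \<open>E\<close> is again independent on the sums, so its size is at
  most the sum of its ranks, which is Rado's condition. Taking \<open>E\<close> itself as the ground
  set makes the cover exact.\<close>

lemma indep_on_sumset_cover:
  assumes Z: "finite Z" "E \<subseteq> Z" and irr: "\<And>i. i \<in> {1..s} \<Longrightarrow> irreducible_on Z (X i)"
    and ind: "indep_on (sumset s X) E"
  shows "\<exists>J. (\<forall>i\<in>{1..s}. J i \<subseteq> E \<and> indep_on (X i) (J i)) \<and> (\<Union>i\<in>{1..s}. J i) = E"
proof (rule matroid_union_cover[where M = "\<lambda>i I. I \<subseteq> E \<and> indep_on (X i) I"])
  show "finite E" using Z finite_subset by blast
  show "finite_matroid E (\<lambda>I. I \<subseteq> E \<and> indep_on (X i) I)" if "i \<in> {1..s}" for i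
    by (rule finite_matroid_indep_on[OF Z irr[OF that]])
  fix F assume F: "F \<subseteq> E"
  have "growth Z (sumset s X) F (\<Sum>i=1..s. finite_matroid.rk (\<lambda>I. I \<subseteq> E \<and> indep_on (X i) I) F)"
    using F Z by (intro growth_sumset growth_rk irr) auto
  then show "card F \<le> (\<Sum>i=1..s. finite_matroid.rk (\<lambda>I. I \<subseteq> E \<and> indep_on (X i) I) F)"
    using F Z by (elim growth_indep_card_le[rotated 2]) (auto intro: indep_on_subset[OF ind])
qed simp

section \<open>Dimension against independence and growth\<close>

lemma variety_dim_ge:
  fixes X :: "(nat \<Rightarrow> 'k::field) set"
  assumes J: "finite J" "J \<subseteq> F" and ind: "indep_on X J"
  shows "enat (card J) \<le> variety_dim F X"
proof -
  define n where "n = card J"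
  obtain \<sigma> where \<sigma>: "bij_betw \<sigma> {..<n} J"
    using ex_bij_betw_nat_finite[OF J(1)] by (auto simp: atLeast0LessThan n_def)
  define v where "v i = (Poly_Mapping.single (Poly_Mapping.single (\<sigma> i) 1) 1 :: 'k mpol)" for i
  have v: "eval_mpol x (v i) = x (\<sigma> i)" for x i
    unfolding v_def eval_mpol_def mon_def[symmetric] by simp
  \<comment> \<open>\<open>variety_dim\<close> numbers its functions from 0 to n - 1, so relations
    between the coordinates in \<open>J\<close> must be renamed along \<open>\<sigma>\<close>;
    \<open>ren\<close> does this to exponent vectors.\<close>
  define ren where "ren m = (\<Sum>i<n. Poly_Mapping.single (\<sigma> i) (Poly_Mapping.lookup m i))"
    for m :: "nat \<Rightarrow>\<^sub>0 nat"
  have inj: "\<sigma> i = \<sigma> j \<longleftrightarrow> i = j" if "i < n" "j < n" for i j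
    using \<sigma> that by (auto simp: bij_betw_def inj_on_def)
  have lookup_ren: "Poly_Mapping.lookup (ren m) (\<sigma> j) = Poly_Mapping.lookup m j" if "j < n" for m j
  proof -
    have "Poly_Mapping.lookup (ren m) (\<sigma> j) = (\<Sum>i<n. if i = j then Poly_Mapping.lookup m i else 0)"
      using that inj by (auto simp: ren_def lookup_sum lookup_single when_def intro!: sum.cong)
    then show ?thesis using that by simp
  qed
  have keys_ren: "Poly_Mapping.keys (ren m) \<subseteq> J" for m
    using \<sigma> by (force simp: ren_def bij_betw_def in_keys_iff lookup_sum lookup_single when_def
        split: if_splits dest!: sum.not_neutral_contains_not_neutral)
  have mon_ren: "mon (ren m) x = mon m (\<lambda>i. if i < n then x (\<sigma> i) else 0)"
    if "Poly_Mapping.keys m \<subseteq> {..<n}" for m and x :: "nat \<Rightarrow> 'k"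
  proof -
    have "mon (ren m) x = (\<Prod>j\<in>J. x j ^ Poly_Mapping.lookup (ren m) j)"
      by (rule mon_superset[OF J(1) keys_ren])
    also have "\<dots> = (\<Prod>i<n. x (\<sigma> i) ^ Poly_Mapping.lookup (ren m) (\<sigma> i))"
      by (rule prod.reindex_bij_betw[OF \<sigma>, symmetric])
    also have "\<dots> = mon m (\<lambda>i. if i < n then x (\<sigma> i) else 0)"
      by (subst mon_superset[OF _ that]) (auto intro!: prod.cong simp: lookup_ren)
    finally show ?thesis .
  qed
  have "alg_independent_on F X n v"
    unfolding alg_independent_on_def
  proof (intro conjI allI impI ballI)
    fix i assume "i < n"
    then have "\<sigma> i \<in> F" using \<sigma> J(2) by (auto simp: bij_betw_def)
    then show "v i \<in> poly_ring F" by (simp add: v_def poly_ring_def)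
  next
    fix q :: "'k mpol"
    assume q: "q \<in> poly_ring {..<n}"
      and 0: "\<forall>x\<in>X. eval_mpol (\<lambda>i. if i < n then eval_mpol x (v i) else 0) q = 0"
    define K where "K = Poly_Mapping.keys q"
    have K: "finite K" "\<And>m. m \<in> K \<Longrightarrow> Poly_Mapping.keys m \<subseteq> {..<n}"
      using q by (auto simp: K_def poly_ring_def)
    have inj_ren: "inj_on ren K"
    proof (rule inj_onI, rule poly_mapping_eqI)
      fix m m' i assume m: "m \<in> K" "m' \<in> K" "ren m = ren m'"
      show "Poly_Mapping.lookup m i = Poly_Mapping.lookup m' i"
      proof (cases "i < n")
        case True
        then show ?thesis using lookup_ren[of i m] lookup_ren[of i m'] m(3) by simp
      next
        case False
        then have "i \<notin> Poly_Mapping.keys m" "i \<notin> Poly_Mapping.keys m'" using K(2) m(1,2) by auto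
        then show ?thesis by (simp add: in_keys_iff)
      qed
    qed
    \<comment> \<open>This is \<open>q\<close> with renamed variables; its coefficients are read
      back through the inverse of \<open>ren\<close>.\<close>
    define p where "p = mpol_of (ren ` K) (\<lambda>m. Poly_Mapping.lookup q (the_inv_into K ren m))"
    have "p \<in> poly_ring J"
      using keys_mpol_of[of "ren ` K"] K(1) keys_ren by (fastforce simp: p_def poly_ring_def)
    moreover have "eval_mpol x p = 0" if "x \<in> X" for x
    proof -
      have "eval_mpol x p = (\<Sum>m\<in>K. Poly_Mapping.lookup q m * mon (ren m) x)"
        by (simp add: p_def eval_mpol_of K(1) sum.reindex[OF inj_ren] the_inv_into_f_f[OF inj_ren])
      also have "\<dots> = eval_mpol (\<lambda>i. if i < n then x (\<sigma> i) else 0) q"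
        by (subst eval_mpol_superset[OF K(1)]) (auto simp: K_def intro!: sum.cong mon_ren K(2)[unfolded K_def])
      finally show ?thesis using 0 that by (simp add: v cong: if_cong)
    qed
    ultimately have "p = 0" using ind by (simp add: indep_on_def)
    have "Poly_Mapping.lookup q m = 0" if "m \<in> K" for m
    proof -
      have "Poly_Mapping.lookup p (ren m) = Poly_Mapping.lookup q m"
        using that by (simp add: p_def lookup_mpol_of K(1) the_inv_into_f_f[OF inj_ren])
      then show ?thesis using \<open>p = 0\<close> by simp
    qed
    then show "q = 0" by (intro poly_mapping_eqI) (metis K_def in_keys_iff lookup_zero)
  qed
  then show ?thesis unfolding variety_dim_def n_def[symmetric] by (intro SUP_upper) auto
qed

lemma polyfun_comp:
  assumes F: "finite F" and A: "finite A" and q: "q \<in> poly_ring A" and g: "\<And>i. i \<in> A \<Longrightarrow> g i \<in> polyfun F"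
  shows "(\<lambda>x. eval_mpol (\<lambda>i. if i \<in> A then g i x else 0) q) \<in> polyfun F"
proof -
  obtain D where D: "\<And>i. i \<in> A \<Longrightarrow> g i \<in> bpoly F D"
    using polyfun_common_degree[OF F A, of g] g by blast
  obtain d where d: "Poly_Mapping.keys q \<subseteq> box A d"
    using finite_subset_box[of "Poly_Mapping.keys q" A] q by (auto simp: poly_ring_def)
  show ?thesis
    unfolding eval_mpol_superset[OF finite_box[OF A] d]
    by (rule bpoly_polyfun[of _ _ "card A * (d * D)"]) (intro bpoly_sum bpoly_scale bpoly_mon_comp F A D)
qed

text \<open>In the application, growth is known on the bare sums while the dimension is that of the
  join of the projections; density carries an algebraic relation from \<open>S\<close> to
  \<open>Y\<close>.\<close>

lemma variety_dim_le:
  assumes Z: "finite Z" "F \<subseteq> Z" and gr: "growth Z S F r" and dense: "dense_in F S Y"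
  shows "variety_dim F Y \<le> enat r"
  unfolding variety_dim_def
proof (rule SUP_least)
  fix n assume "n \<in> {n. \<exists>f. alg_independent_on F Y n f}"
  then obtain f where f: "\<And>i. i < n \<Longrightarrow> f i \<in> poly_ring F"
    and ind: "\<And>q. q \<in> poly_ring {..<n} \<Longrightarrow>
      \<forall>x\<in>Y. eval_mpol (\<lambda>i. if i < n then eval_mpol x (f i) else 0) q = 0 \<Longrightarrow> q = 0"
    unfolding alg_independent_on_def by blast
  have F: "finite F" using Z finite_subset by blast
  have pf: "(\<lambda>x. eval_mpol x (f i)) \<in> polyfun F" if "i \<in> {..<n}" for i
    using that by (intro polyfun_eval F f) simp
  have "card {..<n} \<le> r"
  proof (rule growth_bound[OF Z gr finite_lessThan pf])
    fix q assume q: "q \<in> poly_ring {..<n}"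
      "\<And>x. x \<in> S \<Longrightarrow> eval_mpol (\<lambda>i. if i \<in> {..<n} then eval_mpol x (f i) else 0) q = 0"
    have "eval_mpol (\<lambda>i. if i \<in> {..<n} then eval_mpol x (f i) else 0) q = 0" if "x \<in> Y" for x
      by (rule dense_inD[OF dense polyfun_comp[OF F finite_lessThan q(1) pf] q(2) that])
    then show "q = 0" using ind[OF q(1)] by simp
  qed
  then show "enat n \<le> enat r" by simp
qed

text \<open>The cover of \<open>B\<close> by the \<open>J i\<close> pushes the sum of the dimensions
  up to |B|, so a defect means a join of dimension below |B|. Density in the variables of
  \<open>B\<close> moves this question to the sums of the original \<open>X i\<close>.\<close>

lemma defective_join_proj_iff:
  fixes X :: "nat \<Rightarrow> (nat \<Rightarrow> 'k::field) set"
  assumes Z: "finite Z" "B \<subseteq> Z" and irr: "\<And>i. i \<in> {1..s} \<Longrightarrow> irreducible_on Z (X i)"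
    and J: "\<And>i. i \<in> {1..s} \<Longrightarrow> indep_on (X i) (J i)" and UJ: "(\<Union>i\<in>{1..s}. J i) = B"
  shows "defective_join B s (\<lambda>i. zariski_closure B (coord_proj B ` X i)) \<longleftrightarrow> \<not> indep_on (sumset s X) B"
proof -
  define Y where "Y i = zariski_closure B (coord_proj B ` X i)" for i
  let ?W = "join B s Y"
  have B: "finite B" using Z finite_subset by blast
  have proj: "coord_proj B ` X i \<subseteq> affine_space B" for i
    by (auto simp: coord_proj_def affine_space_def)
  have Y: "Y i \<subseteq> affine_space B" for i
    unfolding Y_def by (rule zariski_closure_subset[OF zariski_closed_affine_space proj])
  have XY: "dense_in B (X i) (Y i)" for i
    unfolding Y_def by (rule dense_in_trans[OF dense_in_coord_proj(1)[OF B] dense_in_zariski_closure[OF B proj]])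
  have YX: "dense_in B (Y i) (X i)" for i
    unfolding Y_def
    by (rule dense_in_trans[OF dense_in_subset[OF zariski_closure_superset] dense_in_coord_proj(2)[OF B]])
  have SW: "dense_in B (sumset s X) ?W"
    unfolding join_eq
    by (rule dense_in_trans[OF dense_in_sumset[OF B XY] dense_in_zariski_closure[OF B]])
       (rule sumset_subset_affine_space[OF Y])
  have WS: "dense_in B ?W (sumset s X)"
    unfolding join_eq
    by (rule dense_in_trans[OF dense_in_subset[OF zariski_closure_superset] dense_in_sumset[OF B YX]])
  have dims: "enat (card B) \<le> (\<Sum>i=1..s. variety_dim B (Y i))"
  proof -
    have "card B \<le> (\<Sum>i=1..s. card (J i))" unfolding UJ[symmetric] by (rule card_UN_le) simp
    then have "enat (card B) \<le> (\<Sum>i=1..s. enat (card (J i)))"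
      by (simp add: of_nat_eq_enat[symmetric] flip: of_nat_sum)
    also have "\<dots> \<le> (\<Sum>i=1..s. variety_dim B (Y i))"
    proof (rule sum_mono)
      fix i assume i: "i \<in> {1..s}"
      then have Ji: "J i \<subseteq> B" using UJ by blast
      show "enat (card (J i)) \<le> variety_dim B (Y i)"
        by (rule variety_dim_ge[OF finite_subset[OF Ji B] Ji indep_on_dense[OF B Ji YX J[OF i]]])
    qed
    finally show ?thesis .
  qed
  then have def: "defective_join B s Y \<longleftrightarrow> variety_dim B ?W < enat (card B)"
    by (simp add: defective_join_def min_absorb2)
  have "\<not> variety_dim B ?W < enat (card B)" if "indep_on (sumset s X) B"
    using variety_dim_ge[OF B order_refl indep_on_dense[OF B order_refl WS that]] by (simp add: not_less)
  moreover have "variety_dim B ?W < enat (card B)" if dep: "\<not> indep_on (sumset s X) B"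
  proof -
    have irrS: "irreducible_on Z (sumset s X)" by (rule irreducible_on_sumset[OF Z(1) irr])
    interpret finite_matroid B "\<lambda>I. I \<subseteq> B \<and> indep_on (sumset s X) I"
      by (rule finite_matroid_indep_on[OF Z irrS])
    \<comment> \<open>A dependent \<open>B\<close> has rank below |B|; the rank is a growth exponent
      on the sums and so bounds the dimension.\<close>
    have "rk B \<noteq> card B" using Ind_if_rk_eq_card[OF order_refl] dep by blast
    then have "rk B < card B" using rk_le_card[OF order_refl] by simp
    moreover have "variety_dim B ?W \<le> enat (rk B)"
      by (rule variety_dim_le[OF Z growth_rk[OF Z irrS order_refl] SW])
    ultimately show ?thesis by (meson enat_ord_simps(2) le_less_trans)
  qed
  ultimately show ?thesis using def unfolding Y_def[abs_def] by blast
qed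

theorem theorem3p3:
  fixes X :: "nat \<Rightarrow> (nat \<Rightarrow> 'k::{alg_closed_field, field_char_0}) set"
    and N s :: nat
  assumes "1 \<le> s"
    and "\<And>i. i \<in> {1..s} \<Longrightarrow> irreducible_variety {1..N} (X i)"
    and "\<And>i. i \<in> {1..s} \<Longrightarrow> affine_cone {1..N} (X i)"
  shows "alg_matroid {1..N} (join {1..N} s X)
           = matroid_union s (\<lambda>i. alg_matroid {1..N} (X i))
         \<longleftrightarrow> \<not> (\<exists>B. matroid_basis (matroid_union s (\<lambda>i. alg_matroid {1..N} (X i))) B \<and>
                   defective_join B s (\<lambda>i. zariski_closure B (coord_proj B ` X i)))"
proof -
  define Z where "Z = {1..N}"
  define S where "S = sumset s X"
  define M where "M = matroid_union s (\<lambda>i. alg_matroid Z (X i))"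
  define P where "P = alg_matroid Z (join Z s X)"
  have Z: "finite Z" by (simp add: Z_def)
  have irr: "irreducible_on Z (X i)" if "i \<in> {1..s}" for i
    using irreducible_variety_imp_irreducible_on[OF Z] assms(2)[OF that] by (simp add: Z_def)
  have "X i \<subseteq> affine_space Z" if "i \<in> {1..s}" for i
    using assms(2)[OF that] zariski_closed_subset by (auto simp: irreducible_variety_def Z_def)
  then have S: "S \<subseteq> affine_space Z" unfolding S_def by (rule sumset_subset_affine_space)
  have P: "I \<in> indep_sets P \<longleftrightarrow> I \<subseteq> Z \<and> indep_on S I" for I
  proof -
    have "indep_on (zariski_closure Z S) I \<longleftrightarrow> indep_on S I" if "I \<subseteq> Z"
      using indep_on_dense[OF Z that dense_in_zariski_closure[OF Z S]]
        indep_on_dense[OF Z that dense_in_subset[OF zariski_closure_superset]] by blast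
    then show ?thesis unfolding P_def indep_sets_alg_matroid join_eq S_def[symmetric] by blast
  qed
  have M: "I \<in> indep_sets M \<longleftrightarrow>
      (\<exists>J. (\<forall>i\<in>{1..s}. J i \<subseteq> Z \<and> indep_on (X i) (J i)) \<and> (\<Union>i\<in>{1..s}. J i) = I)" for I
    unfolding M_def by (auto simp: matroid_union_def indep_sets_alg_matroid)
  have MZ: "I \<subseteq> Z" if "I \<in> indep_sets M" for I
    using that unfolding M by blast
  have defective: "defective_join B s (\<lambda>i. zariski_closure B (coord_proj B ` X i)) \<longleftrightarrow> B \<notin> indep_sets P"
    if B: "B \<in> indep_sets M" for B
  proof -
    obtain J where "\<forall>i\<in>{1..s}. J i \<subseteq> Z \<and> indep_on (X i) (J i)" "(\<Union>i\<in>{1..s}. J i) = B"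
      using B unfolding M by blast
    then have "defective_join B s (\<lambda>i. zariski_closure B (coord_proj B ` X i)) \<longleftrightarrow> \<not> indep_on S B"
      unfolding S_def by (intro defective_join_proj_iff[OF Z MZ[OF B] irr, where J = J]) auto
    then show ?thesis using MZ[OF B] by (simp add: P)
  qed
  have PM: "indep_sets P \<subseteq> indep_sets M"
  proof
    fix I assume "I \<in> indep_sets P"
    then have I: "I \<subseteq> Z" "indep_on (sumset s X) I" by (simp_all add: P S_def)
    obtain J where "\<forall>i\<in>{1..s}. J i \<subseteq> I \<and> indep_on (X i) (J i)" "(\<Union>i\<in>{1..s}. J i) = I"
      using indep_on_sumset_cover[OF Z I(1) irr I(2)] by blast
    with I(1) show "I \<in> indep_sets M" unfolding M by (intro exI[of _ J]) blast
  qed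
  \<comment> \<open>This is where \<open>1 \<le> s\<close> enters: a union over no matroids would
    have an empty ground set.\<close>
  have "ground M = Z" using assms(1) by (auto simp: M_def matroid_union_def alg_matroid_def)
  moreover have "ground P = Z" by (simp add: P_def alg_matroid_def)
  ultimately have "P = M \<longleftrightarrow> indep_sets P = indep_sets M" by (metis matroid.collapse)
  \<comment> \<open>By \<open>PM\<close> only one inclusion is open. Every independent set of
    \<open>M\<close> extends to a basis, and independence in \<open>P\<close> passes to subsets, so
    bases decide.\<close>
  also have "\<dots> \<longleftrightarrow> (\<forall>B. matroid_basis M B \<longrightarrow> B \<in> indep_sets P)"
  proof
    assume "indep_sets P = indep_sets M"
    then show "\<forall>B. matroid_basis M B \<longrightarrow> B \<in> indep_sets P" by (simp add: matroid_basis_def)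
  next
    assume *: "\<forall>B. matroid_basis M B \<longrightarrow> B \<in> indep_sets P"
    have "I \<in> indep_sets P" if I: "I \<in> indep_sets M" for I
    proof -
      have "finite (indep_sets M)" using MZ Z by (auto intro: finite_subset[of _ "Pow Z"])
      from finite_has_maximal2[OF this I] obtain B
        where B: "B \<in> indep_sets M" "I \<subseteq> B" "\<forall>B'\<in>indep_sets M. B \<subseteq> B' \<longrightarrow> B = B'" by blast
      then have "B \<in> indep_sets P" using * by (auto simp: matroid_basis_def)
      with B(2) show ?thesis using indep_on_subset by (auto simp: P)
    qed
    with PM show "indep_sets P = indep_sets M" by blast
  qed
  also have "\<dots> \<longleftrightarrow> \<not> (\<exists>B. matroid_basis M B \<and>
      defective_join B s (\<lambda>i. zariski_closure B (coord_proj B ` X i)))"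
    using defective unfolding matroid_basis_def by blast
  finally show ?thesis unfolding P_def M_def Z_def .
qed

end
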